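(* Let $a<b$, $\alpha\in(0,1)$, $\beta>0$, $y_a,y_b,\gamma\in\mathbb{R}$, and let $L:(x,y,v,w,z)\mapsto L(x,y,v,w,z)$, $G:(x,y,v,w,z)\mapsto G(x,y,v,w,z)$ and $l:(x,y,v,w)\mapsto l(x,y,v,w)$ be real-valued functions of class $C^1$. For $y\in\mathcal{F}([a,b];\mathbb{R})$ put $$z(x)=\int_a^x l\bigl(t,y(t),{^C_aD_t^\alpha}y(t),{_aI_t^\beta}y(t)\bigr)\,dt,$$ $\{y\}(x)=(x,y(x),{^C_aD_x^\alpha}y(x),{_aI_x^\beta}y(x))$, $[y](x)=(x,y(x),{^C_aD_x^\alpha}y(x),{_aI_x^\beta}y(x),z(x))$, $J(y)=\int_a^b L[y](x)\,dx$ and $I(y)=\int_a^b G[y](x)\,dx$. Let $y\in\mathcal{F}([a,b];\mathbb{R})$ be a minimizer of $J$ subject to the boundary conditions $y(a)=y_a$, $y(b)=y_b$ and the isoperimetric constraint $I(y)=\gamma$. Then there exist two constants $\lambda_0$ and $\lambda$, not both zero, such that, with $K=\lambda_0L-\lambda G$, $y$ satisfies for all $x\in[a,b]$ the equation $$\frac{\partial K}{\partial y}[y](x)+{_xD^\alpha_b}\left(\frac{\partial K}{\partial v}[y](x)\right)+{_xI^\beta_b}\left(\frac{\partial K}{\partial w}[y](x)\right)+\int_x^b\frac{\partial K}{\partial z}[y](t)\,dt\cdot\frac{\partial l}{\partial y}\{y\}(x)$$ $$+{_xD^\alpha_b}\left(\int_x^b\frac{\partial K}{\partial z}[y](t)\,dt\cdot\frac{\partial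 l}{\partial v}\{y\}(x)\right)+{_xI^\beta_b}\left(\int_x^b\frac{\partial K}{\partial z}[y](t)\,dt\cdot\frac{\partial l}{\partial w}\{y\}(x)\right)=0.$$
   Context: For $\gamma>0$, the left and right Riemann--Liouville fractional integrals of order $\gamma$ are ${_aI_x^\gamma}f(x)=\frac{1}{\Gamma(\gamma)}\int_a^x(x-t)^{\gamma-1}f(t)\,dt$ and ${_xI_b^\gamma}f(x)=\frac{1}{\Gamma(\gamma)}\int_x^b(t-x)^{\gamma-1}f(t)\,dt$ (this $\gamma$ is unrelated to the constraint constant). For $\alpha\in(0,1)$, the right Riemann--Liouville fractional derivative is ${_xD_b^\alpha}f(x)=\frac{-1}{\Gamma(1-\alpha)}\frac{d}{dx}\int_x^b(t-x)^{-\alpha}f(t)\,dt$, and the left Caputo fractional derivative of an absolutely continuous $f$ is ${^C_aD_x^\alpha}f(x)=\frac{1}{\Gamma(1-\alpha)}\int_a^x(x-t)^{-\alpha}f'(t)\,dt$. $\mathcal{F}([a,b];\mathbb{R})$ denotes the class of absolutely continuous functions $y:[a,b]\to\mathbb{R}$ such that ${^C_aD_x^\alpha}y(x)$ and ${_aI_x^\beta}y(x)$ exist and are continuous on $[a,b]$. Partial derivatives of $L,G,K$ are with respect to their named variables and are evaluated at $[y](\cdot)$; those of $l$ are evaluated at $\{y\}(\cdot)$. An expression such as ${_xD_b^\alpha}(\phi(x))$ means the operator applied to the function $\phi$, evaluated at $x$.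
   Formalization: The two right fractional derivatives in the equation need not exist separately; the theorem proves that the derivative of their sum exists and the equation holds with it for all x, and proves the displayed equation at every x where either of the two separate derivatives exists. *)

theory Defs
  imports "HOL-Analysis.Analysis"
begin

definition abs_continuous_on_interval :: "real \<Rightarrow> real \<Rightarrow> (real \<Rightarrow> real) \<Rightarrow> bool" where
  "abs_continuous_on_interval a b f \<longleftrightarrow>
     (\<forall>\<epsilon>>0. \<exists>\<delta>>0. \<forall>I.
        finite I \<and> (\<forall>(u, v)\<in>I. a \<le> u \<and> u \<le> v \<and> v \<le> b) \<and>
        pairwise (\<lambda>(u, v) (u', v'). disjnt {u<..<v} {u'<..<v'}) I \<and>
        (\<Sum>(u, v)\<in>I. v - u) < \<delta>
        \<longrightarrow> (\<Sum>(u, v)\<in>I. \<bar>f v - f u\<bar>) < \<epsilon>)"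

definition C1_on :: "('a::real_normed_vector \<Rightarrow> 'b::real_normed_vector) \<Rightarrow> 'a set \<Rightarrow> bool" where
  "C1_on f S \<longleftrightarrow>
     (\<exists>f'. (\<forall>p\<in>S. (f has_derivative blinfun_apply (f' p)) (at p within S)) \<and> continuous_on S f')"


(* Existence of an improper integral is absolute (Lebesgue) integrability. Since 0 powr r = 0, the
   kernels below take the value 0 at their singularity, a single point. *)

definition left_RL_integral :: "real \<Rightarrow> real \<Rightarrow> (real \<Rightarrow> real) \<Rightarrow> real \<Rightarrow> real" where
  "left_RL_integral a \<mu> f x =
     1 / Gamma \<mu> * integral {a..x} (\<lambda>t. (x - t) powr (\<mu> - 1) * f t)"

definition left_RL_integral_exists :: "real \<Rightarrow> real \<Rightarrow> (real \<Rightarrow> real) \<Rightarrow> real \<Rightarrow> bool" where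
  "left_RL_integral_exists a \<mu> f x \<longleftrightarrow>
     (\<lambda>t. (x - t) powr (\<mu> - 1) * f t) absolutely_integrable_on {a..x}"

definition right_RL_integral :: "real \<Rightarrow> real \<Rightarrow> (real \<Rightarrow> real) \<Rightarrow> real \<Rightarrow> real" where
  "right_RL_integral b \<mu> f x =
     1 / Gamma \<mu> * integral {x..b} (\<lambda>t. (t - x) powr (\<mu> - 1) * f t)"

(* The outer derivative is taken within {a..b}, i.e. it is one-sided at the two end points. *)

definition right_RL_derivative ::
  "real \<Rightarrow> real \<Rightarrow> real \<Rightarrow> (real \<Rightarrow> real) \<Rightarrow> real \<Rightarrow> real" where
  "right_RL_derivative a b \<alpha> f x =
     - 1 / Gamma (1 - \<alpha>) *
       vector_derivative (\<lambda>s. integral {s..b} (\<lambda>t. (t - s) powr (- \<alpha>) * f t)) (at x within {a..b})"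

definition right_RL_derivative_exists ::
  "real \<Rightarrow> real \<Rightarrow> real \<Rightarrow> (real \<Rightarrow> real) \<Rightarrow> real \<Rightarrow> bool" where
  "right_RL_derivative_exists a b \<alpha> f x \<longleftrightarrow>
     (\<forall>s\<in>{a..b}. (\<lambda>t. (t - s) powr (- \<alpha>) * f t) absolutely_integrable_on {s..b}) \<and>
     (\<lambda>s. integral {s..b} (\<lambda>t. (t - s) powr (- \<alpha>) * f t)) differentiable (at x within {a..b})"

definition left_Caputo_derivative :: "real \<Rightarrow> real \<Rightarrow> (real \<Rightarrow> real) \<Rightarrow> real \<Rightarrow> real" where
  "left_Caputo_derivative a \<alpha> f x =
     1 / Gamma (1 - \<alpha>) * integral {a..x} (\<lambda>t. (x - t) powr (- \<alpha>) * deriv f t)"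

(* deriv f t carries information only where f is differentiable, hence the first conjunct; for an
   absolutely continuous f it is Lebesgue's theorem and so no restriction. *)

definition left_Caputo_derivative_exists :: "real \<Rightarrow> real \<Rightarrow> (real \<Rightarrow> real) \<Rightarrow> real \<Rightarrow> bool" where
  "left_Caputo_derivative_exists a \<alpha> f x \<longleftrightarrow>
     negligible {t \<in> {a..x}. \<not> f differentiable (at t)} \<and>
     (\<lambda>t. (x - t) powr (- \<alpha>) * deriv f t) absolutely_integrable_on {a..x}"

definition frac_class :: "real \<Rightarrow> real \<Rightarrow> real \<Rightarrow> real \<Rightarrow> (real \<Rightarrow> real) set" where
  "frac_class a b \<alpha> \<beta> = {y.
     abs_continuous_on_interval a b y \<and>
     (\<forall>x\<in>{a..b}. left_Caputo_derivative_exists a \<alpha> y x) \<and>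
     continuous_on {a..b} (left_Caputo_derivative a \<alpha> y) \<and>
     (\<forall>x\<in>{a..b}. left_RL_integral_exists a \<beta> y x) \<and>
     continuous_on {a..b} (left_RL_integral a \<beta> y)}"


(* path4, path5 are {y}(x), [y](x); the arguments are ordered (x, y, v, w) and (x, y, v, w, z). *)

definition path4 ::
  "real \<Rightarrow> real \<Rightarrow> real \<Rightarrow> (real \<Rightarrow> real) \<Rightarrow> real \<Rightarrow> real \<times> real \<times> real \<times> real" where
  "path4 a \<alpha> \<beta> y x = (x, y x, left_Caputo_derivative a \<alpha> y x, left_RL_integral a \<beta> y x)"

definition indef_integral ::
  "real \<Rightarrow> real \<Rightarrow> real \<Rightarrow> (real \<times> real \<times> real \<times> real \<Rightarrow> real) \<Rightarrow> (real \<Rightarrow> real) \<Rightarrow> real \<Rightarrow> real" where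
  "indef_integral a \<alpha> \<beta> l y x = integral {a..x} (\<lambda>t. l (path4 a \<alpha> \<beta> y t))"

definition path5 ::
  "real \<Rightarrow> real \<Rightarrow> real \<Rightarrow> (real \<times> real \<times> real \<times> real \<Rightarrow> real) \<Rightarrow> (real \<Rightarrow> real) \<Rightarrow> real
     \<Rightarrow> real \<times> real \<times> real \<times> real \<times> real" where
  "path5 a \<alpha> \<beta> l y x =
     (x, y x, left_Caputo_derivative a \<alpha> y x, left_RL_integral a \<beta> y x, indef_integral a \<alpha> \<beta> l y x)"

definition functional ::
  "real \<Rightarrow> real \<Rightarrow> real \<Rightarrow> real \<Rightarrow> (real \<times> real \<times> real \<times> real \<Rightarrow> real)
     \<Rightarrow> (real \<times> real \<times> real \<times> real \<times> real \<Rightarrow> real) \<Rightarrow> (real \<Rightarrow> real) \<Rightarrow> real" where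
  "functional a b \<alpha> \<beta> l F y = integral {a..b} (\<lambda>x. F (path5 a \<alpha> \<beta> l y x))"

definition admissible ::
  "real \<Rightarrow> real \<Rightarrow> real \<Rightarrow> real \<Rightarrow> (real \<times> real \<times> real \<times> real \<Rightarrow> real)
     \<Rightarrow> (real \<times> real \<times> real \<times> real \<times> real \<Rightarrow> real) \<Rightarrow> real \<Rightarrow> real \<Rightarrow> real \<Rightarrow> (real \<Rightarrow> real) set" where
  "admissible a b \<alpha> \<beta> l G ya yb \<gamma> =
     {y \<in> frac_class a b \<alpha> \<beta>. y a = ya \<and> y b = yb \<and> functional a b \<alpha> \<beta> l G y = \<gamma>}"

definition pd4_y :: "(real \<times> real \<times> real \<times> real \<Rightarrow> real) \<Rightarrow> real \<times> real \<times> real \<times> real \<Rightarrow> real" where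
  "pd4_y f = (\<lambda>(x, y, v, w). deriv (\<lambda>s. f (x, s, v, w)) y)"

definition pd4_v :: "(real \<times> real \<times> real \<times> real \<Rightarrow> real) \<Rightarrow> real \<times> real \<times> real \<times> real \<Rightarrow> real" where
  "pd4_v f = (\<lambda>(x, y, v, w). deriv (\<lambda>s. f (x, y, s, w)) v)"

definition pd4_w :: "(real \<times> real \<times> real \<times> real \<Rightarrow> real) \<Rightarrow> real \<times> real \<times> real \<times> real \<Rightarrow> real" where
  "pd4_w f = (\<lambda>(x, y, v, w). deriv (\<lambda>s. f (x, y, v, s)) w)"

definition pd5_y ::
  "(real \<times> real \<times> real \<times> real \<times> real \<Rightarrow> real) \<Rightarrow> real \<times> real \<times> real \<times> real \<times> real \<Rightarrow> real" where
  "pd5_y f = (\<lambda>(x, y, v, w, z). deriv (\<lambda>s. f (x, s, v, w, z)) y)"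

definition pd5_v ::
  "(real \<times> real \<times> real \<times> real \<times> real \<Rightarrow> real) \<Rightarrow> real \<times> real \<times> real \<times> real \<times> real \<Rightarrow> real" where
  "pd5_v f = (\<lambda>(x, y, v, w, z). deriv (\<lambda>s. f (x, y, s, w, z)) v)"

definition pd5_w ::
  "(real \<times> real \<times> real \<times> real \<times> real \<Rightarrow> real) \<Rightarrow> real \<times> real \<times> real \<times> real \<times> real \<Rightarrow> real" where
  "pd5_w f = (\<lambda>(x, y, v, w, z). deriv (\<lambda>s. f (x, y, v, s, z)) w)"

definition pd5_z ::
  "(real \<times> real \<times> real \<times> real \<times> real \<Rightarrow> real) \<Rightarrow> real \<times> real \<times> real \<times> real \<times> real \<Rightarrow> real" where
  "pd5_z f = (\<lambda>(x, y, v, w, z). deriv (\<lambda>s. f (x, y, v, w, s)) z)"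

end

theory Submission
  imports Defs
begin

text \<open>Vary \<open>y\<close> by primitives \<open>h x = integral {a..x} g\<close> of continuous functions \<open>g\<close> of mean zero; these
  vanish at both end points and stay in the class. Differentiating under the integral sign and
  integrating by parts (also fractionally) turns the first variations of \<open>J\<close> and \<open>I\<close> in the direction
  \<open>h\<close> into integrals of \<open>g\<close> against continuous kernels. By minimality, no two-parameter variation
  \<open>e1 * h1 + e2 * h2\<close> has a surjective derivative for the pair \<open>(J, I)\<close>, so the two first variations are
  linearly dependent as functionals of \<open>g\<close>; this gives the multipliers. For
  \<open>K = lam0 * L - lam * G\<close> the kernel is then constant (du Bois-Reymond). With
  \<open>M x = integral {x..b} (\<lambda>t. K_z t)\<close> it is the integral over \<open>{x..b}\<close> of
  \<open>K_y + M * l_y + I\<^sup>\<beta> (K_w + M * l_w)\<close> plus the right fractional integral of order \<open>1 - \<alpha>\<close> of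
  \<open>K_v + M * l_v\<close>, so the latter is differentiable and differentiation gives the equation.\<close>

text \<open>Regularity is the obstacle. The derivative of \<open>y\<close> may be unbounded, and
  \<open>K_v + M * l_v\<close> is known to be continuous and no more, so its right fractional
  derivative cannot be assumed to exist while integrating by parts. For this reason everything is
  moved onto \<open>g\<close>, the derivative of the direction, and not onto \<open>h\<close>: the
  operators to be transposed are then integrals of orders 1, \<beta> and 1 - \<alpha> acting on
  continuous functions. In particular the Caputo derivative of \<open>h\<close> is the left integral
  of order 1 - \<alpha> of \<open>g\<close>, and \<open>y\<close> enters only through three
  continuous functions: itself, its Caputo derivative and its fractional integral. Differentiability
  of the last term is then a conclusion, because du Bois-Reymond's lemma expresses it by a primitive
  of a continuous function.

  Two parameters are used because moving along a single direction in general violates the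
  constraint; the second one restores the value of \<open>I\<close>. The first multiplier can be 0:
  this is the choice made when the first variation of \<open>I\<close> vanishes in every
  direction.\<close>

subsection \<open>Riemann-Liouville integrals of continuous functions\<close>

text \<open>The substitution \<open>s = ((x - t) / (x - a)) powr \<mu>\<close> absorbs the singular
  kernel into \<open>ds\<close>. What remains is a continuous integrand on an interval that does not
  depend on \<open>x\<close>; existence and continuity in \<open>x\<close> are both read off this
  form.\<close>

lemma left_RL_substitution:
  fixes f :: "real \<Rightarrow> real"
  assumes "a < x" "0 < \<mu>" "continuous_on {a..x} f"
  shows "((\<lambda>t. (x - t) powr (\<mu> - 1) * f t) has_integral
           (x - a) powr \<mu> / \<mu> * integral {0..1} (\<lambda>s. f (x - (x - a) * s powr (1 / \<mu>)))) {a..x}"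
proof -
  define F where "F s = f (x - (x - a) * s powr (1 / \<mu>))" for s
  define g where "g t = ((x - t) / (x - a)) powr \<mu>" for t
  define g' where "g' t = - (\<mu> / (x - a) powr \<mu>) * (x - t) powr (\<mu> - 1)" for t
  have pw: "s powr (1 / \<mu>) \<le> 1" if "s \<in> {0..1}" for s :: real
    using that assms by (intro powr_le1) auto
  have inS: "x - (x - a) * s powr (1 / \<mu>) \<in> {a..x}" if "s \<in> {0..1}" for s :: real
  proof -
    have "(x - a) * s powr (1 / \<mu>) \<le> x - a"
      using pw[OF that] assms by (simp add: mult_left_le)
    moreover have "0 \<le> (x - a) * s powr (1 / \<mu>)" using assms by simp
    ultimately show ?thesis unfolding atLeastAtMost_iff by linarith
  qed
  have F: "continuous_on {0..1} F"
    unfolding F_def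
    by (intro continuous_on_compose2[OF assms(3)] continuous_on_powr' continuous_intros)
      (use inS assms in auto)
  have g: "continuous_on {a..x} g"
    unfolding g_def by (intro continuous_on_powr' continuous_intros) (use assms in auto)
  have sub: "g ` {a..x} \<subseteq> {0..1}"
    using assms by (auto simp: g_def intro!: powr_le1)
  have "((\<lambda>t. g' t *\<^sub>R F (g t)) has_integral (integral {g a..g x} F - integral {g x..g a} F)) {a..x}"
  \<comment> \<open>The point \<open>x\<close> is excepted because for \<open>\<mu> < 1\<close> the
    derivative of \<open>g\<close> blows up there; continuity of \<open>g\<close> on the closed
    interval is all that is required at such a point.\<close>
  proof (rule has_integral_substitution_general[where s="{x}" and c=0 and d=1])
    fix t assume t: "t \<in> {a..x} - {x}"
    then have "(g has_real_derivative g' t) (at t)"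
      unfolding g_def g'_def using assms
      by (auto intro!: derivative_eq_intros simp: powr_divide powr_diff divide_simps)
    then show "(g has_real_derivative g' t) (at t within {a..x})"
      by (rule DERIV_subset) auto
  qed (use assms F g sub in auto)
  moreover have "g a = 1" "g x = 0" using assms by (auto simp: g_def)
  ultimately have "((\<lambda>t. g' t * F (g t)) has_integral - integral {0..1} F) {a..x}"
    by simp
  \<comment> \<open>The factor removes the constant and the sign of \<open>g'\<close>, leaving the
    bare kernel. On the right its sign meets the one produced by \<open>g\<close> running from 1
    down to 0.\<close>
  then have "((\<lambda>t. - ((x - a) powr \<mu> / \<mu>) * (g' t * F (g t))) has_integral
      - ((x - a) powr \<mu> / \<mu>) * - integral {0..1} F) {a..x}"
    by (rule has_integral_mult_right)
  then have I: "((\<lambda>t. - ((x - a) powr \<mu> / \<mu>) * (g' t * F (g t))) has_integral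
      (x - a) powr \<mu> / \<mu> * integral {0..1} F) {a..x}"
    by (simp only: minus_mult_minus)
  have "- ((x - a) powr \<mu> / \<mu>) * (g' t * F (g t)) = (x - t) powr (\<mu> - 1) * f t"
    if "t \<in> {a..x}" for t
  proof -
    have "F (g t) = f t"
      using assms that by (simp add: F_def g_def powr_powr)
    then show ?thesis using assms by (simp add: g'_def)
  qed
  from has_integral_eq[OF this I] show ?thesis
    unfolding F_def .
qed

text \<open>The kernel is nonnegative, so the absolute value of the integrand is the same expression
  with \<open>\<bar>f t\<bar>\<close> for \<open>f t\<close>, and the substitution serves
  both.\<close>

lemma left_RL_kernel_integrable:
  fixes f :: "real \<Rightarrow> real"
  assumes "0 < \<mu>" "continuous_on {a..x} f"
  shows "(\<lambda>t. (x - t) powr (\<mu> - 1) * f t) absolutely_integrable_on {a..x}"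
proof (cases "a < x")
  case True
  have "(\<lambda>t. (x - t) powr (\<mu> - 1) * f t) integrable_on {a..x}"
    using left_RL_substitution[OF True assms] by blast
  moreover have "(\<lambda>t. (x - t) powr (\<mu> - 1) * \<bar>f t\<bar>) integrable_on {a..x}"
    using left_RL_substitution[OF True assms(1) continuous_on_rabs[OF assms(2)]] by blast
  ultimately show ?thesis
    by (intro absolutely_integrable_onI) (auto simp: abs_mult)
next
  case False
  then have "x \<le> a" by simp
  then show ?thesis
    by (intro absolutely_integrable_onI) (simp_all add: integrable_on_null[of a x, simplified])
qed

text \<open>The case \<open>x = a\<close> is included: both sides are 0 there since
  \<open>0 powr \<mu> = 0\<close>. Continuity on the closed interval, end point \<open>a\<close>
  included, rests on this.\<close>

lemma left_RL_integral_eq: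
  fixes f :: "real \<Rightarrow> real"
  assumes "a \<le> x" "0 < \<mu>" "continuous_on {a..x} f"
  shows "left_RL_integral a \<mu> f x =
    1 / Gamma \<mu> * ((x - a) powr \<mu> / \<mu> * integral {0..1} (\<lambda>s. f (x - (x - a) * s powr (1 / \<mu>))))"
proof (cases "a = x")
  case False
  then show ?thesis
    using left_RL_substitution[of a x \<mu> f] assms
    by (auto simp: left_RL_integral_def integral_unique)
qed (simp add: left_RL_integral_def)

lemma continuous_on_left_RL_integral:
  fixes f :: "real \<Rightarrow> real"
  assumes "0 < \<mu>" "continuous_on {a..b} f"
  shows "continuous_on {a..b} (left_RL_integral a \<mu> f)"
proof -
  have inS: "x - (x - a) * s powr (1 / \<mu>) \<in> {a..b}" if "x \<in> {a..b}" "s \<in> {0..1}" for x s :: real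
  proof -
    have "s powr (1 / \<mu>) \<le> 1" using that assms by (intro powr_le1) auto
    then have "(x - a) * s powr (1 / \<mu>) \<le> x - a"
      using that by (simp add: mult_left_le)
    moreover have "0 \<le> (x - a) * s powr (1 / \<mu>)" using that by auto
    ultimately show ?thesis using that unfolding atLeastAtMost_iff by linarith
  qed
  have "continuous_on {a..b} (\<lambda>x. integral (cbox 0 1) (\<lambda>s. f (x - (x - a) * s powr (1 / \<mu>))))"
  proof (rule integral_continuous_on_param)
    show "continuous_on ({a..b} \<times> cbox 0 1) (\<lambda>(x, s). f (x - (x - a) * s powr (1 / \<mu>)))"
      unfolding case_prod_unfold
      by (intro continuous_on_compose2[OF assms(2)] continuous_on_powr' continuous_intros)
        (use inS assms in auto)
  qed
  then have "continuous_on {a..b} (\<lambda>x. 1 / Gamma \<mu> *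
      ((x - a) powr \<mu> / \<mu> * integral {0..1} (\<lambda>s. f (x - (x - a) * s powr (1 / \<mu>)))))"
    by (intro continuous_on_powr' continuous_intros) (use assms Gamma_real_pos[of \<mu>] in auto)
  then show ?thesis
    by (rule continuous_on_eq)
      (use assms in \<open>auto simp: left_RL_integral_eq continuous_on_subset\<close>)
qed

text \<open>Reflection in the origin exchanges right and left integrals, so facts about the former
  are imported from the latter. As an equivalence for \<open>has_integral\<close> it carries over
  integrability as well as the value, whence \<open>right_RL_integral_reflect\<close> holds for
  every \<open>f\<close>.\<close>

lemma right_RL_kernel_reflect:
  fixes f :: "real \<Rightarrow> real"
  shows "((\<lambda>t. (t - x) powr (\<mu> - 1) * f t) has_integral i) {x..b} \<longleftrightarrow>
   ((\<lambda>t. (- x - t) powr (\<mu> - 1) * f (- t)) has_integral i) {- b..- x}"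
  using has_integral_reflect_real[of "\<lambda>t. (t - x) powr (\<mu> - 1) * f t" i b x]
  by (simp add: minus_diff_commute)

lemma right_RL_integral_reflect:
  "right_RL_integral b \<mu> f x = left_RL_integral (- b) \<mu> (\<lambda>t. f (- t)) (- x)"
  by (simp add: right_RL_integral_def left_RL_integral_def integral_def integrable_on_def
      right_RL_kernel_reflect)

lemma right_RL_kernel_integrable:
  fixes f :: "real \<Rightarrow> real"
  assumes "0 < \<mu>" "continuous_on {x..b} f"
  shows "(\<lambda>t. (t - x) powr (\<mu> - 1) * f t) absolutely_integrable_on {x..b}"
proof -
  have c: "continuous_on {- b..- x} (\<lambda>t. f (- t))"
    by (rule continuous_on_compose2[OF assms(2)]) (auto intro!: continuous_intros)
  have "(\<lambda>t. (t - x) powr (\<mu> - 1) * f t) integrable_on {x..b}"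
    using left_RL_kernel_integrable[OF assms(1) c]
    unfolding integrable_on_def right_RL_kernel_reflect
    by (meson absolutely_integrable_on_def integrable_on_def)
  moreover have "(\<lambda>t. (t - x) powr (\<mu> - 1) * \<bar>f t\<bar>) integrable_on {x..b}"
    using left_RL_kernel_integrable[OF assms(1) continuous_on_rabs[OF c]]
    unfolding integrable_on_def right_RL_kernel_reflect
    by (meson absolutely_integrable_on_def integrable_on_def)
  ultimately show ?thesis
    by (intro absolutely_integrable_onI) (auto simp: abs_mult)
qed

lemma continuous_on_right_RL_integral:
  fixes f :: "real \<Rightarrow> real"
  assumes "0 < \<mu>" "continuous_on {a..b} f"
  shows "continuous_on {a..b} (right_RL_integral b \<mu> f)"
proof -
  have "continuous_on {- b..- a} (\<lambda>t. f (- t))"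
    by (rule continuous_on_compose2[OF assms(2)]) (auto intro!: continuous_intros)
  from continuous_on_left_RL_integral[OF assms(1) this]
  have "continuous_on {a..b} (\<lambda>x. left_RL_integral (- b) \<mu> (\<lambda>t. f (- t)) (- x))"
    by (rule continuous_on_compose2) (auto intro!: continuous_intros)
  then show ?thesis
    by (simp add: right_RL_integral_reflect[abs_def])
qed

lemma left_RL_integral_add:
  fixes f g :: "real \<Rightarrow> real"
  assumes "left_RL_integral_exists a \<mu> f x" "left_RL_integral_exists a \<mu> g x"
  shows "left_RL_integral a \<mu> (\<lambda>t. f t + g t) x = left_RL_integral a \<mu> f x + left_RL_integral a \<mu> g x"
  using assms
  by (simp add: left_RL_integral_def left_RL_integral_exists_def absolutely_integrable_on_def
      distrib_left integral_add add_divide_distrib)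

lemma left_RL_integral_cmult:
  "left_RL_integral a \<mu> (\<lambda>t. c * f t) x = c * left_RL_integral a \<mu> f x"
  by (simp add: left_RL_integral_def mult.left_commute)

lemma right_RL_integral_add:
  fixes f g :: "real \<Rightarrow> real"
  assumes "0 < \<mu>" "continuous_on {x..b} f" "continuous_on {x..b} g"
  shows "right_RL_integral b \<mu> (\<lambda>t. f t + g t) x = right_RL_integral b \<mu> f x + right_RL_integral b \<mu> g x"
  using right_RL_kernel_integrable[OF assms(1,2)] right_RL_kernel_integrable[OF assms(1,3)]
  by (simp add: right_RL_integral_def absolutely_integrable_on_def
      distrib_left integral_add add_divide_distrib)

text \<open>Ordinary primitives become fractional integrals of order 1, so that continuity,
  linearity and integration by parts cover them too. The kernel is 1 except at \<open>t = x\<close>,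
  where \<open>0 powr 0\<close> is 0; hence the spike.\<close>

lemma left_RL_integral_1: "left_RL_integral a 1 f x = integral {a..x} f"
proof -
  have "integral {a..x} (\<lambda>t. (x - t) powr (1 - 1) * f t) = integral {a..x} f"
    by (rule integral_spike[of "{x}"]) (auto simp: powr_def)
  then show ?thesis by (simp add: left_RL_integral_def)
qed

lemma right_RL_integral_1: "right_RL_integral b 1 f x = integral {x..b} f"
proof -
  have "integral {x..b} (\<lambda>t. (t - x) powr (1 - 1) * f t) = integral {x..b} f"
    by (rule integral_spike[of "{x}"]) (auto simp: powr_def)
  then show ?thesis by (simp add: right_RL_integral_def)
qed

section \<open>Fractional integration by parts\<close>

text \<open>The operators are defined by gauge integrals, while Fubini's theorem is applied over
  \<open>lborel\<close>. Absolute integrability gives Lebesgue integrability over the completed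
  measure, and Borel measurability of \<open>k\<close> permits the descent to
  \<open>lborel\<close>.\<close>

lemma lborel_integral_of_absolutely_integrable:
  fixes q :: "real \<Rightarrow> real"
  assumes q: "q absolutely_integrable_on S" and k: "k = (\<lambda>t. indicator S t * q t)"
    and m: "k \<in> borel_measurable borel"
  shows "integrable lborel k" "integral\<^sup>L lborel k = Henstock_Kurzweil_Integration.integral S q"
proof -
  have m': "k \<in> borel_measurable lborel" using m by simp
  have "integrable lebesgue k"
    using q by (simp add: k set_integrable_def)
  then show "integrable lborel k"
    using integrable_completion[OF m'] by simp
  have "integral\<^sup>L lborel k = integral\<^sup>L lebesgue k"
    using integral_completion[OF m'] by simp
  also have "\<dots> = Henstock_Kurzweil_Integration.integral S q"
    using set_lebesgue_integral_eq_integral(2)[OF q]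
    by (simp add: k set_lebesgue_integral_def)
  finally show "integral\<^sup>L lborel k = Henstock_Kurzweil_Integration.integral S q" .
qed

text \<open>Fractional integration by parts is Fubini's theorem for
  \<open>(x - t) powr (\<mu> - 1) * f x * g t\<close> on the triangle \<open>a \<le> t \<le> x \<le> b\<close>.\<close>

lemma left_right_RL_integral_adjoint:
  fixes f g :: "real \<Rightarrow> real"
  assumes \<mu>: "0 < \<mu>" and f: "continuous_on {a..b} f" and g: "continuous_on {a..b} g"
  shows "integral {a..b} (\<lambda>x. f x * left_RL_integral a \<mu> g x) =
         integral {a..b} (\<lambda>t. g t * right_RL_integral b \<mu> f t)"
proof -
  \<comment> \<open>Extension by zero makes both factors Borel functions on the whole line; together
    with the condition \<open>t \<le> x\<close> in \<open>H\<close> it cuts the triangle out of the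
    plane.\<close>
  define F where "F = (\<lambda>x. indicator {a..b} x *\<^sub>R f x)"
  define G where "G = (\<lambda>x. indicator {a..b} x *\<^sub>R g x)"
  define H where "H x t = (if t \<le> x then (x - t) powr (\<mu> - 1) * F x * G t else 0)" for x t
  have [measurable]: "F \<in> borel_measurable borel" "G \<in> borel_measurable borel"
    unfolding F_def G_def
    by (rule borel_measurable_continuous_on_indicator; use f g in simp)+
  have mH [measurable]: "case_prod H \<in> borel_measurable (lborel \<Otimes>\<^sub>M lborel)"
    unfolding H_def by measurable
  have row: "integrable lborel (H x) \<and> integral\<^sup>L lborel (H x) =
      indicator {a..b} x * (f x * (Gamma \<mu> * left_RL_integral a \<mu> g x))" for x
  proof (cases "x \<in> {a..b}")
    case True
    then have "continuous_on {a..x} (\<lambda>t. f x * g t)"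
      by (auto intro!: continuous_intros continuous_on_subset[OF g])
    from left_RL_kernel_integrable[OF \<mu> this]
    have *: "(\<lambda>t. f x * ((x - t) powr (\<mu> - 1) * g t)) absolutely_integrable_on {a..x}"
      by (simp add: mult_ac)
    have "H x = (\<lambda>t. indicator {a..x} t * (f x * ((x - t) powr (\<mu> - 1) * g t)))"
      using True by (auto simp: H_def F_def G_def indicator_def fun_eq_iff)
    from lborel_integral_of_absolutely_integrable[OF * this]
    show ?thesis
      using True Gamma_real_pos[OF \<mu>] unfolding H_def left_RL_integral_def by simp
  next
    case False
    then have "H x = (\<lambda>t. 0)" by (auto simp: H_def F_def)
    then show ?thesis using False by simp
  qed
  \<comment> \<open>This is the Tonelli condition: the inner integrals of the norm of
    \<open>H\<close> form a left integral of \<open>\<bar>g\<bar>\<close> times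
    \<open>\<bar>f\<bar>\<close>, which is continuous on \<open>{a..b}\<close> and therefore
    integrable.\<close>
  have row_norm: "integral\<^sup>L lborel (\<lambda>t. norm (H x t)) =
      indicator {a..b} x * (\<bar>f x\<bar> * (Gamma \<mu> * left_RL_integral a \<mu> (\<lambda>t. \<bar>g t\<bar>) x))" for x
  proof (cases "x \<in> {a..b}")
    case True
    then have "continuous_on {a..x} (\<lambda>t. \<bar>f x\<bar> * \<bar>g t\<bar>)"
      by (auto intro!: continuous_intros continuous_on_subset[OF g])
    from left_RL_kernel_integrable[OF \<mu> this]
    have *: "(\<lambda>t. \<bar>f x\<bar> * ((x - t) powr (\<mu> - 1) * \<bar>g t\<bar>)) absolutely_integrable_on {a..x}"
      by (simp add: mult_ac)
    have "(\<lambda>t. norm (H x t)) = (\<lambda>t. indicator {a..x} t * (\<bar>f x\<bar> * ((x - t) powr (\<mu> - 1) * \<bar>g t\<bar>)))"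
      using True by (auto simp: H_def F_def G_def indicator_def fun_eq_iff abs_mult)
    from lborel_integral_of_absolutely_integrable[OF * this]
    show ?thesis
      using True Gamma_real_pos[OF \<mu>] unfolding H_def left_RL_integral_def by simp
  next
    case False
    then have "H x = (\<lambda>t. 0)" by (auto simp: H_def F_def)
    then show ?thesis using False by simp
  qed
  have col: "integral\<^sup>L lborel (\<lambda>x. H x t) =
      indicator {a..b} t * (g t * (Gamma \<mu> * right_RL_integral b \<mu> f t))" for t
  proof (cases "t \<in> {a..b}")
    case True
    then have "continuous_on {t..b} (\<lambda>x. g t * f x)"
      by (auto intro!: continuous_intros continuous_on_subset[OF f])
    from right_RL_kernel_integrable[OF \<mu> this]
    have *: "(\<lambda>x. g t * ((x - t) powr (\<mu> - 1) * f x)) absolutely_integrable_on {t..b}"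
      by (simp add: mult_ac)
    have "(\<lambda>x. H x t) = (\<lambda>x. indicator {t..b} x * (g t * ((x - t) powr (\<mu> - 1) * f x)))"
      using True by (auto simp: H_def F_def G_def indicator_def fun_eq_iff)
    from lborel_integral_of_absolutely_integrable[OF * this]
    show ?thesis
      using True Gamma_real_pos[OF \<mu>] unfolding H_def right_RL_integral_def by simp
  next
    case False
    then have "(\<lambda>x. H x t) = (\<lambda>x. 0)" by (auto simp: H_def G_def)
    then show ?thesis using False by simp
  qed
  have lc: "continuous_on {a..b} (left_RL_integral a \<mu> g)"
    and rc: "continuous_on {a..b} (right_RL_integral b \<mu> f)"
    and nc: "continuous_on {a..b} (left_RL_integral a \<mu> (\<lambda>t. \<bar>g t\<bar>))"
    by (intro continuous_on_left_RL_integral continuous_on_right_RL_integral continuous_intros \<mu> f g)+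
  have outer: "integral\<^sup>L lborel (\<lambda>x. indicator {a..b} x * h x) = Henstock_Kurzweil_Integration.integral {a..b} h"
    if "continuous_on {a..b} h" for h :: "real \<Rightarrow> real"
    using borel_measurable_continuous_on_indicator[OF _ that]
    by (intro lborel_integral_of_absolutely_integrable(2)
        absolutely_integrable_continuous_real[OF that]) auto
  have "integrable (lborel \<Otimes>\<^sub>M lborel) (case_prod H)"
  proof (rule lborel_pair.Fubini_integrable[OF mH])
    have "integrable lborel (\<lambda>x. indicator {a..b} x *\<^sub>R
        (\<bar>f x\<bar> * (Gamma \<mu> * left_RL_integral a \<mu> (\<lambda>t. \<bar>g t\<bar>) x)))"
      by (intro borel_integrable_compact continuous_intros f nc) auto
    then show "integrable lborel (\<lambda>x. \<integral>y. norm (case (x, y) of (x, y) \<Rightarrow> H x y) \<partial>lborel)"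
      unfolding prod.case row_norm by simp
  qed (use row in auto)
  from lborel_pair.Fubini_integral[OF this]
  have "Henstock_Kurzweil_Integration.integral {a..b} (\<lambda>t. g t * (Gamma \<mu> * right_RL_integral b \<mu> f t)) =
        Henstock_Kurzweil_Integration.integral {a..b} (\<lambda>x. f x * (Gamma \<mu> * left_RL_integral a \<mu> g x))"
    using row by (simp add: col outer continuous_intros f g lc rc)
  then show ?thesis
    using Gamma_real_pos[OF \<mu>] by (simp add: mult.left_commute)
qed

text \<open>The function \<open>W\<close> minus its mean has mean zero and is thus a permitted test
  function. Orthogonality to \<open>W\<close>, and to constants, makes the integral of its square
  vanish.\<close>

lemma du_Bois_Reymond:
  fixes W :: "real \<Rightarrow> real"
  assumes ab: "a < b" and W: "continuous_on {a..b} W"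
    and orth: "\<And>g. continuous_on {a..b} g \<Longrightarrow> integral {a..b} g = 0 \<Longrightarrow> integral {a..b} (\<lambda>t. g t * W t) = 0"
  obtains m where "\<And>x. x \<in> {a..b} \<Longrightarrow> W x = m"
proof
  define m where "m = integral {a..b} W / (b - a)"
  define g where "g t = W t - m" for t
  have g: "continuous_on {a..b} g" unfolding g_def by (intro continuous_intros W)
  have gi: "g integrable_on {a..b}" and Wi: "W integrable_on {a..b}"
    by (intro integrable_continuous_real g W)+
  have "integral {a..b} g = integral {a..b} W - integral {a..b} (\<lambda>t. m)"
    unfolding g_def by (rule Henstock_Kurzweil_Integration.integral_diff[OF Wi])
      (intro integrable_continuous_real continuous_on_const)
  then have g0: "integral {a..b} g = 0" using ab by (simp add: m_def)
  have "integral {a..b} (\<lambda>t. g t * g t) = integral {a..b} (\<lambda>t. g t * W t - m * g t)"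
    by (rule Henstock_Kurzweil_Integration.integral_cong) (simp only: g_def, algebra)
  also have "\<dots> = integral {a..b} (\<lambda>t. g t * W t) - integral {a..b} (\<lambda>t. m * g t)"
    by (intro Henstock_Kurzweil_Integration.integral_diff integrable_continuous_real continuous_intros g W)
  also have "\<dots> = 0" by (simp only: orth[OF g g0] Henstock_Kurzweil_Integration.integral_mult_right g0 mult_zero_right diff_zero)
  finally have "integral {a..b} (\<lambda>t. g t * g t) = 0" .
  moreover have "continuous_on {a..b} (\<lambda>t. g t * g t)" by (intro continuous_intros g)
  ultimately have "\<forall>x\<in>{a..b}. g x * g x = 0"
    using integral_eq_0_iff[of a b "\<lambda>t. g t * g t"] ab by simp
  then show "W x = m" if "x \<in> {a..b}" for x
    using that by (simp add: g_def)
qed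

subsection \<open>Partial derivatives\<close>

text \<open>At the boundary of \<open>A\<close> the derivative of \<open>F\<close> is only a
  derivative within \<open>A\<close>. A curve that lies entirely in \<open>A\<close> turns it into a
  two-sided derivative, which is what \<open>deriv\<close> needs. The curves used later vary one
  coordinate other than \<open>x\<close>, so they stay in \<open>{a..b} \<times> UNIV\<close> even
  when \<open>x\<close> is an end point.\<close>

lemma deriv_along_section:
  fixes F :: "'a::real_normed_vector \<Rightarrow> real"
  assumes F: "(F has_derivative F') (at (c y) within A)" and c: "(c has_derivative c') (at y)"
    and A: "range c \<subseteq> A"
  shows "deriv (\<lambda>s. F (c s)) y = F' (c' 1)"
proof -
  have D: "((\<lambda>s. F (c s)) has_derivative (\<lambda>s. F' (c' s))) (at y)"
    by (rule has_derivative_in_compose[OF c has_derivative_subset[OF F A]])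
  have "(\<lambda>s. F' (c' s)) = (*) (F' (c' 1))"
  proof
    show "F' (c' s) = F' (c' 1) * s" for s
      using linear.scaleR[OF has_derivative_linear[OF D], of s 1] by (simp add: mult.commute)
  qed
  with D have "((\<lambda>s. F (c s)) has_field_derivative F' (c' 1)) (at y)"
    unfolding has_field_derivative_def by (simp only:)
  then show ?thesis by (rule DERIV_imp_deriv)
qed

lemma pd4_has_derivative:
  assumes f: "(f has_derivative f') (at p within S \<times> UNIV)" and p: "p \<in> S \<times> UNIV"
  shows "pd4_y f p = f' (0, 1, 0, 0)" "pd4_v f p = f' (0, 0, 1, 0)" "pd4_w f p = f' (0, 0, 0, 1)"
    "f' (0, d1, d2, d3) = pd4_y f p * d1 + pd4_v f p * d2 + pd4_w f p * d3"
proof -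
  obtain x y v w where p_eq: "p = (x, y, v, w)" by (cases p) auto
  have x: "x \<in> S" using p p_eq by simp
  interpret bounded_linear f' using f by (rule has_derivative_bounded_linear)
  show y: "pd4_y f p = f' (0, 1, 0, 0)" unfolding pd4_y_def p_eq prod.case
    by (rule deriv_along_section[where c="\<lambda>s. (x, s, v, w)" and c'="\<lambda>s. (0, s, 0, 0)", OF f[unfolded p_eq]])
      (use x in \<open>auto intro!: has_derivative_Pair\<close>)
  show v: "pd4_v f p = f' (0, 0, 1, 0)" unfolding pd4_v_def p_eq prod.case
    by (rule deriv_along_section[where c="\<lambda>s. (x, y, s, w)" and c'="\<lambda>s. (0, 0, s, 0)", OF f[unfolded p_eq]])
      (use x in \<open>auto intro!: has_derivative_Pair\<close>)
  show w: "pd4_w f p = f' (0, 0, 0, 1)" unfolding pd4_w_def p_eq prod.case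
    by (rule deriv_along_section[where c="\<lambda>s. (x, y, v, s)" and c'="\<lambda>s. (0, 0, 0, s)", OF f[unfolded p_eq]])
      (use x in \<open>auto intro!: has_derivative_Pair\<close>)
  have "(0, d1, d2, d3) = d1 *\<^sub>R (0, 1, 0, 0) + d2 *\<^sub>R (0, 0, 1, 0) + d3 *\<^sub>R (0::real, 0::real, 0::real, 1::real)"
    by simp
  then show "f' (0, d1, d2, d3) = pd4_y f p * d1 + pd4_v f p * d2 + pd4_w f p * d3"
    by (simp only: add scaleR y v w real_scaleR_def mult.commute)
qed

lemma pd5_has_derivative:
  assumes f: "(f has_derivative f') (at p within S \<times> UNIV)" and p: "p \<in> S \<times> UNIV"
  shows "pd5_y f p = f' (0, 1, 0, 0, 0)" "pd5_v f p = f' (0, 0, 1, 0, 0)"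
    "pd5_w f p = f' (0, 0, 0, 1, 0)" "pd5_z f p = f' (0, 0, 0, 0, 1)"
    "f' (0, d1, d2, d3, d4) = pd5_y f p * d1 + pd5_v f p * d2 + pd5_w f p * d3 + pd5_z f p * d4"
proof -
  obtain x y v w z where p_eq: "p = (x, y, v, w, z)" by (cases p) auto
  have x: "x \<in> S" using p p_eq by simp
  interpret bounded_linear f' using f by (rule has_derivative_bounded_linear)
  show y: "pd5_y f p = f' (0, 1, 0, 0, 0)" unfolding pd5_y_def p_eq prod.case
    by (rule deriv_along_section[where c="\<lambda>s. (x, s, v, w, z)" and c'="\<lambda>s. (0, s, 0, 0, 0)", OF f[unfolded p_eq]])
      (use x in \<open>auto intro!: has_derivative_Pair\<close>)
  show v: "pd5_v f p = f' (0, 0, 1, 0, 0)" unfolding pd5_v_def p_eq prod.case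
    by (rule deriv_along_section[where c="\<lambda>s. (x, y, s, w, z)" and c'="\<lambda>s. (0, 0, s, 0, 0)", OF f[unfolded p_eq]])
      (use x in \<open>auto intro!: has_derivative_Pair\<close>)
  show w: "pd5_w f p = f' (0, 0, 0, 1, 0)" unfolding pd5_w_def p_eq prod.case
    by (rule deriv_along_section[where c="\<lambda>s. (x, y, v, s, z)" and c'="\<lambda>s. (0, 0, 0, s, 0)", OF f[unfolded p_eq]])
      (use x in \<open>auto intro!: has_derivative_Pair\<close>)
  show z: "pd5_z f p = f' (0, 0, 0, 0, 1)" unfolding pd5_z_def p_eq prod.case
    by (rule deriv_along_section[where c="\<lambda>s. (x, y, v, w, s)" and c'="\<lambda>s. (0, 0, 0, 0, s)", OF f[unfolded p_eq]])
      (use x in \<open>auto intro!: has_derivative_Pair\<close>)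
  have "(0, d1, d2, d3, d4) = d1 *\<^sub>R (0, 1, 0, 0, 0) + d2 *\<^sub>R (0, 0, 1, 0, 0)
      + d3 *\<^sub>R (0, 0, 0, 1, 0) + d4 *\<^sub>R (0::real, 0::real, 0::real, 0::real, 1::real)"
    by simp
  then show "f' (0, d1, d2, d3, d4) = pd5_y f p * d1 + pd5_v f p * d2 + pd5_w f p * d3 + pd5_z f p * d4"
    by (simp only: add scaleR y v w z real_scaleR_def mult.commute)
qed

lemma C1_on_linear_combination:
  fixes f g :: "'a::real_normed_vector \<Rightarrow> real"
  assumes "C1_on f S" "C1_on g S"
  shows "C1_on (\<lambda>p. c * f p - d * g p) S"
proof -
  obtain f' g' where
    f: "\<And>p. p \<in> S \<Longrightarrow> (f has_derivative blinfun_apply (f' p)) (at p within S)" "continuous_on S f'" and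
    g: "\<And>p. p \<in> S \<Longrightarrow> (g has_derivative blinfun_apply (g' p)) (at p within S)" "continuous_on S g'"
    using assms unfolding C1_on_def by blast
  have "((\<lambda>p. c * f p - d * g p) has_derivative blinfun_apply (c *\<^sub>R f' p - d *\<^sub>R g' p)) (at p within S)"
    if "p \<in> S" for p
  proof -
    have "blinfun_apply (c *\<^sub>R f' p - d *\<^sub>R g' p) = (\<lambda>x. c * f' p x - d * g' p x)"
      by (simp add: fun_eq_iff blinfun.bilinear_simps)
    then show ?thesis
      using has_derivative_diff[OF has_derivative_mult_right[OF f(1)[OF that], of c]
        has_derivative_mult_right[OF g(1)[OF that], of d]]
      by simp
  qed
  moreover have "continuous_on S (\<lambda>p. c *\<^sub>R f' p - d *\<^sub>R g' p)"
    by (intro continuous_on_diff continuous_on_scaleR continuous_on_const f(2) g(2))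
  ultimately show ?thesis
    unfolding C1_on_def by (intro exI[of _ "\<lambda>p. c *\<^sub>R f' p - d *\<^sub>R g' p"] conjI ballI)
qed

lemma C1_on_imp_continuous_on: "C1_on f S \<Longrightarrow> continuous_on S f"
  unfolding C1_on_def continuous_on_eq_continuous_within by (blast intro: has_derivative_continuous)

lemma continuous_on_pd4:
  assumes "C1_on f (S \<times> UNIV)"
  shows "continuous_on (S \<times> UNIV) (pd4_y f)" "continuous_on (S \<times> UNIV) (pd4_v f)"
    "continuous_on (S \<times> UNIV) (pd4_w f)"
proof -
  obtain f' where f': "\<And>p. p \<in> S \<times> UNIV \<Longrightarrow> (f has_derivative blinfun_apply (f' p)) (at p within S \<times> UNIV)"
    and c: "continuous_on (S \<times> UNIV) f'"
    using assms unfolding C1_on_def by blast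
  have cd: "continuous_on (S \<times> UNIV) (\<lambda>p. blinfun_apply (f' p) d)" for d
    by (intro continuous_intros c)
  note eq = pd4_has_derivative(1-3)[OF f']
  show "continuous_on (S \<times> UNIV) (pd4_y f)" "continuous_on (S \<times> UNIV) (pd4_v f)"
    "continuous_on (S \<times> UNIV) (pd4_w f)"
    by (simp_all add: eq cd cong: continuous_on_cong)
qed

lemma continuous_on_pd5:
  assumes "C1_on f (S \<times> UNIV)"
  shows "continuous_on (S \<times> UNIV) (pd5_y f)" "continuous_on (S \<times> UNIV) (pd5_v f)"
    "continuous_on (S \<times> UNIV) (pd5_w f)" "continuous_on (S \<times> UNIV) (pd5_z f)"
proof -
  obtain f' where f': "\<And>p. p \<in> S \<times> UNIV \<Longrightarrow> (f has_derivative blinfun_apply (f' p)) (at p within S \<times> UNIV)"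
    and c: "continuous_on (S \<times> UNIV) f'"
    using assms unfolding C1_on_def by blast
  have cd: "continuous_on (S \<times> UNIV) (\<lambda>p. blinfun_apply (f' p) d)" for d
    by (intro continuous_intros c)
  note eq = pd5_has_derivative(1-4)[OF f']
  show "continuous_on (S \<times> UNIV) (pd5_y f)" "continuous_on (S \<times> UNIV) (pd5_v f)"
    "continuous_on (S \<times> UNIV) (pd5_w f)" "continuous_on (S \<times> UNIV) (pd5_z f)"
    by (simp_all add: eq cd cong: continuous_on_cong)
qed

subsection \<open>Differentiable families of functions\<close>

text \<open>The parameter \<open>e\<close> carries the variation and is the only variable of
  differentiation. Joint continuity in \<open>(e, t)\<close>, with \<open>f'\<close> in operator
  norm, is what differentiation under the integral sign asks for, and it survives pairing,
  composition and indefinite integration. The derivative of the functional is assembled by these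
  closure rules.\<close>

definition C1_family ::
  "real set \<Rightarrow> ('e::banach \<Rightarrow> real \<Rightarrow> 'c::banach) \<Rightarrow> ('e \<Rightarrow> real \<Rightarrow> 'e \<Rightarrow>\<^sub>L 'c) \<Rightarrow> bool" where
  "C1_family T f f' \<longleftrightarrow>
     (\<forall>e. \<forall>t\<in>T. ((\<lambda>e. f e t) has_derivative blinfun_apply (f' e t)) (at e)) \<and>
     continuous_on (UNIV \<times> T) (\<lambda>(e, t). f e t) \<and>
     continuous_on (UNIV \<times> T) (\<lambda>(e, t). f' e t)"

lemma C1_familyI:
  assumes "\<And>e t. t \<in> T \<Longrightarrow> ((\<lambda>e. f e t) has_derivative blinfun_apply (f' e t)) (at e)"
    and "continuous_on (UNIV \<times> T) (\<lambda>p. f (fst p) (snd p))"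
    and "continuous_on (UNIV \<times> T) (\<lambda>p. f' (fst p) (snd p))"
  shows "C1_family T f f'"
  using assms by (simp add: C1_family_def case_prod_unfold)

lemma C1_familyD:
  assumes "C1_family T f f'"
  shows "\<And>e t. t \<in> T \<Longrightarrow> ((\<lambda>e. f e t) has_derivative blinfun_apply (f' e t)) (at e)"
    and "continuous_on (UNIV \<times> T) (\<lambda>p. f (fst p) (snd p))"
    and "continuous_on (UNIV \<times> T) (\<lambda>p. f' (fst p) (snd p))"
  using assms by (simp_all add: C1_family_def case_prod_unfold)

lemma continuous_on_slice:
  assumes "continuous_on (UNIV \<times> T) (\<lambda>p. g (fst p) (snd p))"
  shows "continuous_on T (g e)"
proof -
  have "continuous_on T (\<lambda>t. (\<lambda>p. g (fst p) (snd p)) (e, t))"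
    by (rule continuous_on_compose2[OF assms]) (auto intro!: continuous_intros)
  then show ?thesis by simp
qed

text \<open>Rescaling to the fixed interval \<open>{0..1}\<close> makes joint continuity in the parameter and the
  upper limit an instance of continuity of parameter integrals.\<close>

lemma continuous_on_indefinite_integral_param:
  fixes g :: "'e::topological_space \<Rightarrow> real \<Rightarrow> 'c::banach"
  assumes g: "continuous_on (UNIV \<times> {a..b}) (\<lambda>p. g (fst p) (snd p))"
  shows "continuous_on (UNIV \<times> {a..b}) (\<lambda>p. integral {a..snd p} (g (fst p)))"
proof -
  have scale: "integral {a..x} (g e) = (x - a) *\<^sub>R integral (cbox 0 1) (\<lambda>s. g e ((x - a) * s + a))"
    if x: "x \<in> {a..b}" for e x
  proof (cases "x = a")
    case False
    then have ax: "a < x" using x by simp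
    have "continuous_on {a..x} (g e)"
      by (rule continuous_on_subset[OF continuous_on_slice[OF g]]) (use x in auto)
    then have "(g e has_integral integral {a..x} (g e)) (cbox a x)"
      by (simp add: integrable_integral integrable_continuous_real)
    from has_integral_affinity[OF this, of "x - a" a] ax
    have "((\<lambda>s. g e ((x - a) * s + a)) has_integral (1 / (x - a)) *\<^sub>R integral {a..x} (g e))
        ((\<lambda>s. 1 / (x - a) * s + - (1 / (x - a) * a)) ` {a..x})"
      by simp
    also have "(\<lambda>s. 1 / (x - a) * s + - (1 / (x - a) * a)) ` {a..x} = {0..1}"
      unfolding image_affinity_atLeastAtMost using ax
      by (simp add: diff_divide_distrib[symmetric])
    finally show ?thesis using ax by (simp add: integral_unique)
  qed simp
  have "continuous_on (UNIV \<times> {a..b})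
      (\<lambda>p. integral (cbox 0 1) (\<lambda>s. g (fst p) ((snd p - a) * s + a)))"
  proof (rule integral_continuous_on_param)
    have in_ab: "(x - a) * s + a \<in> {a..b}" if "x \<in> {a..b}" "s \<in> {0..1}" for x s
    proof -
      have "(x - a) * s \<le> x - a" using that by (simp add: mult_left_le)
      moreover have "0 \<le> (x - a) * s" using that by simp
      ultimately show ?thesis using that unfolding atLeastAtMost_iff by linarith
    qed
    have "continuous_on ((UNIV \<times> {a..b}) \<times> cbox 0 1)
        (\<lambda>q. (\<lambda>p. g (fst p) (snd p)) (fst (fst q), (snd (fst q) - a) * snd q + a))"
      by (rule continuous_on_compose2[OF g]) (use in_ab in \<open>auto intro!: continuous_intros\<close>)
    then show "continuous_on ((UNIV \<times> {a..b}) \<times> cbox 0 1)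
        (\<lambda>(p, s). g (fst p) ((snd p - a) * s + a))"
      by (simp add: case_prod_unfold)
  qed
  then have "continuous_on (UNIV \<times> {a..b})
      (\<lambda>p. (snd p - a) *\<^sub>R integral (cbox 0 1) (\<lambda>s. g (fst p) ((snd p - a) * s + a)))"
    by (intro continuous_intros)
  then show ?thesis
    by (rule continuous_on_eq) (auto simp: scale)
qed

text \<open>This handles \<open>z\<close>, which depends on the path through an integral with
  variable upper limit. The Leibniz rule gives the derivative as the integral of an operator-valued
  function; joint continuity of the integral and of its derivative are two instances of the
  preceding lemma.\<close>

lemma C1_family_indefinite_integral:
  assumes F: "C1_family {a..b} f f'"
  shows "C1_family {a..b} (\<lambda>e x. integral {a..x} (f e)) (\<lambda>e x. integral {a..x} (f' e))"
proof (rule C1_familyI)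
  fix e x assume x: "x \<in> {a..b}"
  have "((\<lambda>e. integral (cbox a x) (f e)) has_derivative integral (cbox a x) (f' e)) (at e within UNIV)"
  proof (rule leibniz_rule)
    show "((\<lambda>e. f e t) has_derivative f' e t) (at e within UNIV)" if "t \<in> cbox a x" for e t
      using C1_familyD(1)[OF F, of t e] that x by simp
    show "f e integrable_on cbox a x" for e
      by (rule integrable_continuous, rule continuous_on_subset[OF continuous_on_slice[OF C1_familyD(2)[OF F]]])
        (use x in auto)
    show "continuous_on (UNIV \<times> cbox a x) (\<lambda>(e, t). f' e t)"
      unfolding case_prod_unfold
      by (rule continuous_on_subset[OF C1_familyD(3)[OF F]]) (use x in auto)
  qed auto
  then show "((\<lambda>e. integral {a..x} (f e)) has_derivative integral {a..x} (f' e)) (at e)"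
    by simp
qed (use C1_familyD[OF F] in \<open>auto intro: continuous_on_indefinite_integral_param\<close>)

lemma C1_family_Pair:
  assumes f: "C1_family T f f'" and g: "C1_family T g g'"
  obtains h' where "C1_family T (\<lambda>e t. (f e t, g e t)) h'"
    "\<And>e t d. blinfun_apply (h' e t) d = (f' e t d, g' e t d)"
proof
  \<comment> \<open>Composing with the two fixed injections and adding exhibits the derivative of
    the pair as an expression in \<open>blinfun\<close> operations, from which its continuity in
    operator norm follows.\<close>
  define inl where "inl = Blinfun (\<lambda>x::'b. (x, 0::'c))"
  define inr where "inr = Blinfun (\<lambda>x::'c. (0::'b, x))"
  have inl: "blinfun_apply inl = (\<lambda>x. (x, 0))"
    unfolding inl_def by (rule bounded_linear_Blinfun_apply) (intro bounded_linear_Pair bounded_linear_ident bounded_linear_zero)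
  have inr: "blinfun_apply inr = (\<lambda>x. (0, x))"
    unfolding inr_def by (rule bounded_linear_Blinfun_apply) (intro bounded_linear_Pair bounded_linear_ident bounded_linear_zero)
  define h' where "h' e t = (inl o\<^sub>L f' e t) + (inr o\<^sub>L g' e t)" for e t
  show h': "blinfun_apply (h' e t) d = (f' e t d, g' e t d)" for e t d
    by (simp add: h'_def blinfun.bilinear_simps inl inr)
  show "C1_family T (\<lambda>e t. (f e t, g e t)) h'"
  proof (rule C1_familyI)
    fix e t assume "t \<in> T"
    from has_derivative_Pair[OF C1_familyD(1)[OF f this] C1_familyD(1)[OF g this], of e]
    show "((\<lambda>e. (f e t, g e t)) has_derivative h' e t) (at e)"
      by (rule has_derivative_eq_rhs) (simp add: fun_eq_iff h')
  next
    show "continuous_on (UNIV \<times> T) (\<lambda>p. (f (fst p) (snd p), g (fst p) (snd p)))"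
      by (intro continuous_on_Pair C1_familyD(2)[OF f] C1_familyD(2)[OF g])
    show "continuous_on (UNIV \<times> T) (\<lambda>p. h' (fst p) (snd p))"
      unfolding h'_def
      by (intro continuous_on_add bounded_bilinear.continuous_on[OF bounded_bilinear_blinfun_compose]
          continuous_on_const C1_familyD(3)[OF f] C1_familyD(3)[OF g])
  qed
qed

text \<open>For fixed \<open>t\<close> the curve \<open>(t, q e t)\<close> never leaves
  \<open>T \<times> UNIV\<close>, so differentiability of \<open>F\<close> within that set gives
  unrestricted differentiability in \<open>e\<close>, again in directions with first component
  0.\<close>

lemma C1_family_compose:
  fixes F :: "real \<times> 'c::banach \<Rightarrow> 'd::banach"
  assumes F: "\<And>p. p \<in> T \<times> UNIV \<Longrightarrow> (F has_derivative blinfun_apply (F' p)) (at p within T \<times> UNIV)"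
    and F': "continuous_on (T \<times> UNIV) F'" and q: "C1_family T q q'"
  obtains h' where "C1_family T (\<lambda>e t. F (t, q e t)) h'"
    "\<And>e t d. blinfun_apply (h' e t) d = F' (t, q e t) (0, q' e t d)"
proof
  define inr where "inr = Blinfun (\<lambda>x::'c. (0::real, x))"
  have inr: "blinfun_apply inr = (\<lambda>x. (0, x))"
    unfolding inr_def by (rule bounded_linear_Blinfun_apply) (intro bounded_linear_Pair bounded_linear_ident bounded_linear_zero)
  define h' where "h' e t = F' (t, q e t) o\<^sub>L (inr o\<^sub>L q' e t)" for e t
  show h': "blinfun_apply (h' e t) d = F' (t, q e t) (0, q' e t d)" for e t d
    by (simp add: h'_def inr)
  have Fc: "continuous_on (T \<times> UNIV) F"
    using F by (auto simp: continuous_on_eq_continuous_within intro: has_derivative_continuous)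
  have path: "continuous_on (UNIV \<times> T) (\<lambda>p. (snd p, q (fst p) (snd p)))"
    by (intro continuous_on_Pair C1_familyD(2)[OF q] continuous_on_snd continuous_on_id)
  show "C1_family T (\<lambda>e t. F (t, q e t)) h'"
  proof (rule C1_familyI)
    fix e t assume t: "t \<in> T"
    have "((\<lambda>e. (t, q e t)) has_derivative (\<lambda>d. (0, q' e t d))) (at e)"
      by (intro has_derivative_Pair has_derivative_const C1_familyD(1)[OF q t])
    from has_derivative_in_compose[OF this has_derivative_subset[OF F]] t
    have "((\<lambda>e. F (t, q e t)) has_derivative (\<lambda>d. F' (t, q e t) (0, q' e t d))) (at e)"
      by auto
    then show "((\<lambda>e. F (t, q e t)) has_derivative h' e t) (at e)"
      by (rule has_derivative_eq_rhs) (simp add: fun_eq_iff h')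
  next
    show "continuous_on (UNIV \<times> T) (\<lambda>p. F (snd p, q (fst p) (snd p)))"
      by (rule continuous_on_compose2[OF Fc path]) auto
    have "continuous_on (UNIV \<times> T) (\<lambda>p. F' (snd p, q (fst p) (snd p)))"
      by (rule continuous_on_compose2[OF F' path]) auto
    then show "continuous_on (UNIV \<times> T) (\<lambda>p. h' (fst p) (snd p))"
      unfolding h'_def
      by (intro bounded_bilinear.continuous_on[OF bounded_bilinear_blinfun_compose]
          continuous_on_const C1_familyD(3)[OF q])
  qed
qed

lemma C1_family_affine:
  fixes y h k :: "real \<Rightarrow> real"
  assumes y: "continuous_on T y" and h: "continuous_on T h" and k: "continuous_on T k"
  obtains q' :: "real \<times> real \<Rightarrow> real \<Rightarrow> (real \<times> real) \<Rightarrow>\<^sub>L real"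
  where "C1_family T (\<lambda>e t. y t + (fst e * h t + snd e * k t)) q'"
    "\<And>e t d. blinfun_apply (q' e t) d = fst d * h t + snd d * k t"
proof
  define q' :: "real \<times> real \<Rightarrow> real \<Rightarrow> (real \<times> real) \<Rightarrow>\<^sub>L real"
    where "q' e t = h t *\<^sub>R fst_blinfun + k t *\<^sub>R snd_blinfun" for e t
  show q': "blinfun_apply (q' e t) d = fst d * h t + snd d * k t" for e t d
    by (simp add: q'_def blinfun.bilinear_simps)
  have c: "continuous_on (UNIV \<times> T) (\<lambda>p. f (snd p))" if "continuous_on T f" for f :: "real \<Rightarrow> real"
    by (rule continuous_on_compose2[OF that]) (auto intro!: continuous_intros)
  show "C1_family T (\<lambda>e t. y t + (fst e * h t + snd e * k t)) q'"
  proof (rule C1_familyI)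
    fix e :: "real \<times> real" and t
    have "((\<lambda>e. y t + (fst e * h t + snd e * k t)) has_derivative
        (\<lambda>d. 0 + (fst d * h t + snd d * k t))) (at e)"
      by (intro has_derivative_add has_derivative_const has_derivative_mult_left
          has_derivative_fst has_derivative_snd has_derivative_ident)
    then show "((\<lambda>e. y t + (fst e * h t + snd e * k t)) has_derivative q' e t) (at e)"
      by (rule has_derivative_eq_rhs) (simp add: fun_eq_iff q')
  next
    show "continuous_on (UNIV \<times> T) (\<lambda>p. y (snd p) + (fst (fst p) * h (snd p) + snd (fst p) * k (snd p)))"
      by (intro continuous_intros c y h k)
    show "continuous_on (UNIV \<times> T) (\<lambda>p. q' (fst p) (snd p))"
      unfolding q'_def by (intro continuous_intros c h k)
  qed
qed

section \<open>Derivative of the functional along a two-parameter variation\<close>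

text \<open>Fractional operators do not occur here: \<open>Q\<close> and \<open>P\<close> stand for
  \<open>path4\<close> and \<open>path5\<close> of the varied function, whose second to fourth
  components are affine in \<open>e\<close> by linearity. \<open>T\<close> is the chain rule applied
  to one direction, its inner integral being the variation of \<open>z\<close>.\<close>

lemma functional_family_has_derivative:
  fixes F :: "real \<times> real \<times> real \<times> real \<times> real \<Rightarrow> real"
    and l :: "real \<times> real \<times> real \<times> real \<Rightarrow> real"
  assumes ab: "a \<le> b" and F: "C1_on F ({a..b} \<times> UNIV)" and l: "C1_on l ({a..b} \<times> UNIV)"
    and cy: "continuous_on {a..b} y" "continuous_on {a..b} h1" "continuous_on {a..b} h2"
    and cv: "continuous_on {a..b} v" "continuous_on {a..b} k1" "continuous_on {a..b} k2"
    and cw: "continuous_on {a..b} w" "continuous_on {a..b} m1" "continuous_on {a..b} m2"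
  defines "Q \<equiv> \<lambda>(e::real \<times> real) t. (t, y t + (fst e * h1 t + snd e * h2 t),
      v t + (fst e * k1 t + snd e * k2 t), w t + (fst e * m1 t + snd e * m2 t))"
  defines "P \<equiv> \<lambda>(e::real \<times> real) x. (x, y x + (fst e * h1 x + snd e * h2 x),
      v x + (fst e * k1 x + snd e * k2 x), w x + (fst e * m1 x + snd e * m2 x),
      integral {a..x} (\<lambda>t. l (Q e t)))"
  defines "T \<equiv> \<lambda>h k m. integral {a..b} (\<lambda>x.
      pd5_y F (P 0 x) * h x + pd5_v F (P 0 x) * k x + pd5_w F (P 0 x) * m x
      + pd5_z F (P 0 x) * integral {a..x} (\<lambda>t.
          pd4_y l (Q 0 t) * h t + pd4_v l (Q 0 t) * k t + pd4_w l (Q 0 t) * m t))"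
  obtains J' :: "real \<times> real \<Rightarrow> (real \<times> real) \<Rightarrow>\<^sub>L real"
  where "\<And>e. ((\<lambda>e. integral {a..b} (\<lambda>x. F (P e x))) has_derivative blinfun_apply (J' e)) (at e)"
    "\<And>d. blinfun_apply (J' 0) d = fst d * T h1 k1 m1 + snd d * T h2 k2 m2"
proof -
  obtain F' where F': "\<And>p. p \<in> {a..b} \<times> UNIV \<Longrightarrow> (F has_derivative blinfun_apply (F' p)) (at p within {a..b} \<times> UNIV)"
      "continuous_on ({a..b} \<times> UNIV) F'"
    using F unfolding C1_on_def by blast
  obtain l' where l': "\<And>p. p \<in> {a..b} \<times> UNIV \<Longrightarrow> (l has_derivative blinfun_apply (l' p)) (at p within {a..b} \<times> UNIV)"
      "continuous_on ({a..b} \<times> UNIV) l'"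
    using l unfolding C1_on_def by blast
  obtain y' where y': "C1_family {a..b} (\<lambda>e t. y t + (fst e * h1 t + snd e * h2 t)) y'"
      "\<And>e t d. blinfun_apply (y' e t) d = fst d * h1 t + snd d * h2 t"
    by (rule C1_family_affine[OF cy], rule that)
  obtain v' where v': "C1_family {a..b} (\<lambda>e t. v t + (fst e * k1 t + snd e * k2 t)) v'"
      "\<And>e t d. blinfun_apply (v' e t) d = fst d * k1 t + snd d * k2 t"
    by (rule C1_family_affine[OF cv], rule that)
  obtain w' where w': "C1_family {a..b} (\<lambda>e t. w t + (fst e * m1 t + snd e * m2 t)) w'"
      "\<And>e t d. blinfun_apply (w' e t) d = fst d * m1 t + snd d * m2 t"
    by (rule C1_family_affine[OF cw], rule that)
  \<comment> \<open>Tuples nest to the right, so the paths are built from the last component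
    forwards. The path \<open>Q\<close> comes first because \<open>z\<close>, the last component of
    \<open>P\<close>, integrates \<open>l\<close> along it.\<close>
  obtain vw' where vw': "C1_family {a..b} (\<lambda>e t. (v t + (fst e * k1 t + snd e * k2 t),
        w t + (fst e * m1 t + snd e * m2 t))) vw'"
      "\<And>e t d. blinfun_apply (vw' e t) d = (v' e t d, w' e t d)"
    by (rule C1_family_Pair[OF v'(1) w'(1)], rule that)
  obtain q' where q': "C1_family {a..b} (\<lambda>e t. (y t + (fst e * h1 t + snd e * h2 t),
        v t + (fst e * k1 t + snd e * k2 t), w t + (fst e * m1 t + snd e * m2 t))) q'"
      "\<And>e t d. blinfun_apply (q' e t) d = (y' e t d, vw' e t d)"
    by (rule C1_family_Pair[OF y'(1) vw'(1)], rule that)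
  obtain lq' where lq': "C1_family {a..b} (\<lambda>e t. l (Q e t)) lq'"
      "\<And>e t d. blinfun_apply (lq' e t) d = l' (Q e t) (0, q' e t d)"
    unfolding Q_def by (rule C1_family_compose[OF l' q'(1)], assumption, rule that[unfolded Q_def])
  note z' = C1_family_indefinite_integral[OF lq'(1)]
  obtain wz' where wz': "C1_family {a..b} (\<lambda>e x. (w x + (fst e * m1 x + snd e * m2 x),
        integral {a..x} (\<lambda>t. l (Q e t)))) wz'"
      "\<And>e x d. blinfun_apply (wz' e x) d = (w' e x d, integral {a..x} (lq' e) d)"
    by (rule C1_family_Pair[OF w'(1) z'], rule that)
  obtain vwz' where vwz': "C1_family {a..b} (\<lambda>e x. (v x + (fst e * k1 x + snd e * k2 x),
        w x + (fst e * m1 x + snd e * m2 x), integral {a..x} (\<lambda>t. l (Q e t)))) vwz'"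
      "\<And>e x d. blinfun_apply (vwz' e x) d = (v' e x d, wz' e x d)"
    by (rule C1_family_Pair[OF v'(1) wz'(1)], rule that)
  obtain p' where p': "C1_family {a..b} (\<lambda>e x. (y x + (fst e * h1 x + snd e * h2 x),
        v x + (fst e * k1 x + snd e * k2 x), w x + (fst e * m1 x + snd e * m2 x),
        integral {a..x} (\<lambda>t. l (Q e t)))) p'"
      "\<And>e x d. blinfun_apply (p' e x) d = (y' e x d, vwz' e x d)"
    by (rule C1_family_Pair[OF y'(1) vwz'(1)], rule that)
  obtain Fp' where Fp': "C1_family {a..b} (\<lambda>e x. F (P e x)) Fp'"
      "\<And>e x d. blinfun_apply (Fp' e x) d = F' (P e x) (0, p' e x d)"
    unfolding P_def by (rule C1_family_compose[OF F' p'(1)], assumption, rule that[unfolded P_def])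
  define J' where "J' e = integral {a..b} (Fp' e)" for e
  have der: "((\<lambda>e. integral {a..b} (\<lambda>x. F (P e x))) has_derivative J' e) (at e)" for e
    unfolding J'_def
    by (rule C1_familyD(1)[OF C1_family_indefinite_integral[OF Fp'(1)]]) (simp add: ab)
  have lq_int: "lq' e integrable_on {a..x}" if "x \<in> {a..b}" for e x
    by (rule integrable_continuous_real, rule continuous_on_subset[OF continuous_on_slice[OF C1_familyD(3)[OF lq'(1)]]])
      (use that in auto)
  have Fp_int: "Fp' e integrable_on {a..b}" for e
    by (rule integrable_continuous_real, rule continuous_on_slice[OF C1_familyD(3)[OF Fp'(1)]])
  have PS: "P e x \<in> {a..b} \<times> UNIV" and QS: "Q e x \<in> {a..b} \<times> UNIV" if "x \<in> {a..b}" for e x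
    using that by (auto simp: P_def Q_def)
  have J'_apply: "J' 0 d = T (\<lambda>x. fst d * h1 x + snd d * h2 x) (\<lambda>x. fst d * k1 x + snd d * k2 x)
      (\<lambda>x. fst d * m1 x + snd d * m2 x)" for d
    unfolding J'_def T_def blinfun_apply_integral[OF Fp_int]
  proof (rule Henstock_Kurzweil_Integration.integral_cong)
    fix x assume x: "x \<in> {a..b}"
    have "integral {a..x} (lq' 0) d = integral {a..x} (\<lambda>t.
          pd4_y l (Q 0 t) * (fst d * h1 t + snd d * h2 t) + pd4_v l (Q 0 t) * (fst d * k1 t + snd d * k2 t)
          + pd4_w l (Q 0 t) * (fst d * m1 t + snd d * m2 t))"
      unfolding blinfun_apply_integral[OF lq_int[OF x]]
    proof (rule Henstock_Kurzweil_Integration.integral_cong)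
      fix t assume "t \<in> {a..x}"
      then have t: "t \<in> {a..b}" using x by auto
      show "lq' 0 t d = pd4_y l (Q 0 t) * (fst d * h1 t + snd d * h2 t)
          + pd4_v l (Q 0 t) * (fst d * k1 t + snd d * k2 t) + pd4_w l (Q 0 t) * (fst d * m1 t + snd d * m2 t)"
        unfolding lq'(2) q'(2) vw'(2) y'(2) v'(2) w'(2)
        by (rule pd4_has_derivative(4)[OF l'(1)[OF QS[OF t]] QS[OF t]])
    qed
    then show "Fp' 0 x d = pd5_y F (P 0 x) * (fst d * h1 x + snd d * h2 x)
        + pd5_v F (P 0 x) * (fst d * k1 x + snd d * k2 x) + pd5_w F (P 0 x) * (fst d * m1 x + snd d * m2 x)
        + pd5_z F (P 0 x) * integral {a..x} (\<lambda>t.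
          pd4_y l (Q 0 t) * (fst d * h1 t + snd d * h2 t) + pd4_v l (Q 0 t) * (fst d * k1 t + snd d * k2 t)
          + pd4_w l (Q 0 t) * (fst d * m1 t + snd d * m2 t))"
      unfolding Fp'(2) p'(2) vwz'(2) wz'(2) y'(2) v'(2) w'(2)
      by (simp only: pd5_has_derivative(5)[OF F'(1)[OF PS[OF x]] PS[OF x]])
  qed
  have "J' 0 d = fst d * T h1 k1 m1 + snd d * T h2 k2 m2" for d
  proof -
    \<comment> \<open>The formula is needed at the two unit vectors only; linearity of
      \<open>J' 0\<close> then distributes \<open>d\<close> over the directions, in place of
      splitting the integrals in \<open>T\<close>.\<close>
    have "J' 0 d = J' 0 (fst d *\<^sub>R (1, 0) + snd d *\<^sub>R (0, 1))" by simp
    also have "\<dots> = fst d * J' 0 (1, 0) + snd d * J' 0 (0, 1)"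
      by (simp only: blinfun.add_right blinfun.scaleR_right real_scaleR_def)
    also have "J' 0 (1, 0) = T h1 k1 m1" unfolding J'_apply by simp
    also have "J' 0 (0, 1) = T h2 k2 m2" unfolding J'_apply by simp
    finally show ?thesis .
  qed
  with der show thesis by (rule that)
qed

text \<open>Each operator on the direction is transposed by
  \<open>left_right_RL_integral_adjoint\<close>. Order 1 applied to \<open>Fz\<close> gives
  \<open>M\<close> and merges the terms of \<open>l\<close> with those of \<open>F\<close> into
  \<open>A\<close>, \<open>B\<close>, \<open>C\<close>. Since \<open>m\<close> is built from
  \<open>h\<close> and \<open>h\<close> from \<open>g\<close>, \<open>C\<close> is moved twice,
  first by order \<beta> and then by order 1. In the application \<open>\<mu>\<close> is
  \<open>1 - \<alpha>\<close>.\<close>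

lemma first_variation_eq:
  fixes Fy Fv Fw Fz ly lv lw g :: "real \<Rightarrow> real"
  assumes \<mu>: "0 < \<mu>" and \<beta>: "0 < \<beta>" and g: "continuous_on {a..b} g"
    and F: "continuous_on {a..b} Fy" "continuous_on {a..b} Fv" "continuous_on {a..b} Fw" "continuous_on {a..b} Fz"
    and l: "continuous_on {a..b} ly" "continuous_on {a..b} lv" "continuous_on {a..b} lw"
  defines "h \<equiv> left_RL_integral a 1 g"
  defines "k \<equiv> left_RL_integral a \<mu> g"
  defines "m \<equiv> left_RL_integral a \<beta> h"
  defines "M \<equiv> \<lambda>s. integral {s..b} Fz"
  defines "A \<equiv> \<lambda>s. Fy s + M s * ly s"
  defines "B \<equiv> \<lambda>s. Fv s + M s * lv s"
  defines "C \<equiv> \<lambda>s. Fw s + M s * lw s"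
  shows "integral {a..b} (\<lambda>x. Fy x * h x + Fv x * k x + Fw x * m x
      + Fz x * integral {a..x} (\<lambda>t. ly t * h t + lv t * k t + lw t * m t)) =
    integral {a..b} (\<lambda>t. g t * (right_RL_integral b 1 (\<lambda>s. A s + right_RL_integral b \<beta> C s) t
      + right_RL_integral b \<mu> B t))"
proof -
  define q where "q t = ly t * h t + lv t * k t + lw t * m t" for t
  have one: "(0::real) < 1" by simp
  have h: "continuous_on {a..b} h" and k: "continuous_on {a..b} k" and m: "continuous_on {a..b} m"
    unfolding h_def k_def m_def by (intro continuous_on_left_RL_integral one \<mu> \<beta> g)+
  have q: "continuous_on {a..b} q" unfolding q_def by (intro continuous_intros h k m l)
  have M_eq: "M = right_RL_integral b 1 Fz" unfolding M_def by (simp add: fun_eq_iff right_RL_integral_1)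
  have M: "continuous_on {a..b} M" unfolding M_eq by (intro continuous_on_right_RL_integral one F)
  have A: "continuous_on {a..b} A" and B: "continuous_on {a..b} B" and C: "continuous_on {a..b} C"
    unfolding A_def B_def C_def by (intro continuous_intros M F l)+
  have IC: "continuous_on {a..b} (right_RL_integral b \<beta> C)"
    by (intro continuous_on_right_RL_integral \<beta> C)
  note iadd = Henstock_Kurzweil_Integration.integral_add[OF integrable_continuous_real integrable_continuous_real]
  have E1: "integral {a..b} (\<lambda>x. (Fy x * h x + Fv x * k x + Fw x * m x) + Fz x * integral {a..x} q)
      = integral {a..b} (\<lambda>x. Fy x * h x + Fv x * k x + Fw x * m x)
        + integral {a..b} (\<lambda>x. Fz x * left_RL_integral a 1 q x)"
    unfolding left_RL_integral_1[of a q, symmetric]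
    by (intro iadd continuous_intros F h k m continuous_on_left_RL_integral one q)
  have E2: "integral {a..b} (\<lambda>x. Fz x * left_RL_integral a 1 q x) = integral {a..b} (\<lambda>t. q t * M t)"
    unfolding M_eq by (rule left_right_RL_integral_adjoint[OF one F(4) q])
  have E3: "integral {a..b} (\<lambda>x. (Fy x * h x + Fv x * k x + Fw x * m x) + q x * M x)
      = integral {a..b} (\<lambda>x. Fy x * h x + Fv x * k x + Fw x * m x) + integral {a..b} (\<lambda>t. q t * M t)"
    by (intro iadd continuous_intros F h k m q M)
  have E4: "integral {a..b} (\<lambda>x. (Fy x * h x + Fv x * k x + Fw x * m x) + q x * M x)
      = integral {a..b} (\<lambda>x. A x * h x + (B x * k x + C x * m x))"
    by (rule Henstock_Kurzweil_Integration.integral_cong) (simp add: A_def B_def C_def q_def algebra_simps)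
  have E5: "integral {a..b} (\<lambda>x. A x * h x + (B x * k x + C x * m x))
      = integral {a..b} (\<lambda>x. A x * h x) + integral {a..b} (\<lambda>x. B x * k x + C x * m x)"
    by (intro iadd continuous_intros A B C h k m)
  have E6: "integral {a..b} (\<lambda>x. B x * k x + C x * m x) = integral {a..b} (\<lambda>x. B x * k x) + integral {a..b} (\<lambda>x. C x * m x)"
    by (intro iadd continuous_intros B C k m)
  have E7: "integral {a..b} (\<lambda>x. C x * m x) = integral {a..b} (\<lambda>x. h x * right_RL_integral b \<beta> C x)"
    unfolding m_def by (rule left_right_RL_integral_adjoint[OF \<beta> C h])
  have E8: "integral {a..b} (\<lambda>x. (A x + right_RL_integral b \<beta> C x) * h x)
      = integral {a..b} (\<lambda>x. A x * h x) + integral {a..b} (\<lambda>x. h x * right_RL_integral b \<beta> C x)"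
    unfolding distrib_right mult.commute[of "right_RL_integral b \<beta> C _"]
    by (intro iadd continuous_intros A IC h)
  have E9: "integral {a..b} (\<lambda>x. (A x + right_RL_integral b \<beta> C x) * h x)
      = integral {a..b} (\<lambda>t. g t * right_RL_integral b 1 (\<lambda>s. A s + right_RL_integral b \<beta> C s) t)"
    unfolding h_def by (rule left_right_RL_integral_adjoint[OF one _ g]) (intro continuous_intros A IC)
  have E10: "integral {a..b} (\<lambda>x. B x * k x) = integral {a..b} (\<lambda>t. g t * right_RL_integral b \<mu> B t)"
    unfolding k_def by (rule left_right_RL_integral_adjoint[OF \<mu> B g])
  have E11: "integral {a..b} (\<lambda>t. g t * (right_RL_integral b 1 (\<lambda>s. A s + right_RL_integral b \<beta> C s) t
        + right_RL_integral b \<mu> B t))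
      = integral {a..b} (\<lambda>t. g t * right_RL_integral b 1 (\<lambda>s. A s + right_RL_integral b \<beta> C s) t)
        + integral {a..b} (\<lambda>t. g t * right_RL_integral b \<mu> B t)"
    unfolding distrib_left
    by (intro iadd continuous_intros continuous_on_right_RL_integral one \<mu> A B IC g)
  show ?thesis
    using E1 E2 E3 E4 E5 E6 E7 E8 E9 E10 E11 unfolding q_def by linarith
qed

subsection \<open>Perturbations inside the function class\<close>

lemma abs_continuous_on_intervalE:
  assumes "abs_continuous_on_interval a b f" "0 < \<epsilon>"
  obtains \<delta> where "0 < \<delta>"
    "\<And>I. finite I \<Longrightarrow> (\<forall>(u, v)\<in>I. a \<le> u \<and> u \<le> v \<and> v \<le> b) \<Longrightarrow>
        pairwise (\<lambda>(u, v) (u', v'). disjnt {u<..<v} {u'<..<v'}) I \<Longrightarrow>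
        (\<Sum>(u, v)\<in>I. v - u) < \<delta> \<Longrightarrow> (\<Sum>(u, v)\<in>I. \<bar>f v - f u\<bar>) < \<epsilon>"
proof -
  from assms(1)[unfolded abs_continuous_on_interval_def, THEN spec, THEN mp, OF assms(2)]
  show ?thesis
  proof (elim exE conjE, goal_cases)
    case (1 \<delta>)
    show ?thesis
      by (rule that[OF 1(1)], rule 1(2)[THEN spec, THEN mp], intro conjI; assumption)
  qed
qed

lemma abs_continuous_on_interval_add_Lipschitz:
  assumes y: "abs_continuous_on_interval a b y" and B: "0 \<le> B"
    and h: "\<And>u v. a \<le> u \<Longrightarrow> u \<le> v \<Longrightarrow> v \<le> b \<Longrightarrow> \<bar>h v - h u\<bar> \<le> B * (v - u)"
  shows "abs_continuous_on_interval a b (\<lambda>x. y x + h x)"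
  unfolding abs_continuous_on_interval_def
proof (intro allI impI)
  fix \<epsilon> :: real assume "0 < \<epsilon>"
  then have half: "0 < \<epsilon> / 2" by simp
  obtain \<delta> where \<delta>: "0 < \<delta>" and
    \<delta>_y: "\<And>I. finite I \<Longrightarrow> (\<forall>(u, v)\<in>I. a \<le> u \<and> u \<le> v \<and> v \<le> b) \<Longrightarrow>
        pairwise (\<lambda>(u, v) (u', v'). disjnt {u<..<v} {u'<..<v'}) I \<Longrightarrow>
        (\<Sum>(u, v)\<in>I. v - u) < \<delta> \<Longrightarrow> (\<Sum>(u, v)\<in>I. \<bar>y v - y u\<bar>) < \<epsilon> / 2"
    by (rule abs_continuous_on_intervalE[OF y half], rule that)
  \<comment> \<open>With \<open>B + 1\<close> in place of \<open>B\<close> the quotient is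
    meaningful for \<open>B = 0\<close>, and \<open>B / (2 * (B + 1))\<close> is at most 1/2, so the
    part of \<open>h\<close> contributes at most \<open>\<epsilon> / 2\<close>.\<close>
  define \<delta>' where "\<delta>' = min \<delta> (\<epsilon> / (2 * (B + 1)))"
  have "(\<Sum>(u, v)\<in>I. \<bar>(y v + h v) - (y u + h u)\<bar>) < \<epsilon>"
    if I: "finite I" "\<forall>(u, v)\<in>I. a \<le> u \<and> u \<le> v \<and> v \<le> b"
        "pairwise (\<lambda>(u, v) (u', v'). disjnt {u<..<v} {u'<..<v'}) I" "(\<Sum>(u, v)\<in>I. v - u) < \<delta>'" for I
  proof -
    have "(\<Sum>(u, v)\<in>I. \<bar>(y v + h v) - (y u + h u)\<bar>) \<le> (\<Sum>(u, v)\<in>I. \<bar>y v - y u\<bar> + B * (v - u))"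
    proof (rule sum_mono)
      fix p assume "p \<in> I"
      then obtain u v where p: "p = (u, v)" "a \<le> u" "u \<le> v" "v \<le> b" using I(2) by auto
      from h[OF p(2-4)] show "(case p of (u, v) \<Rightarrow> \<bar>(y v + h v) - (y u + h u)\<bar>) \<le>
          (case p of (u, v) \<Rightarrow> \<bar>y v - y u\<bar> + B * (v - u))"
        unfolding p(1) by simp
    qed
    also have "\<dots> = (\<Sum>(u, v)\<in>I. \<bar>y v - y u\<bar>) + B * (\<Sum>(u, v)\<in>I. v - u)"
      by (simp add: sum.distrib sum_distrib_left case_prod_unfold)
    also have "\<dots> < \<epsilon> / 2 + \<epsilon> / 2"
    proof (rule add_less_le_mono)
      show "(\<Sum>(u, v)\<in>I. \<bar>y v - y u\<bar>) < \<epsilon> / 2"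
        by (rule \<delta>_y[OF I(1-3)]) (use I(4) in \<open>simp add: \<delta>'_def\<close>)
      have "B * (\<Sum>(u, v)\<in>I. v - u) \<le> B * (\<epsilon> / (2 * (B + 1)))"
        by (rule mult_left_mono) (use I(4) B in \<open>auto simp: \<delta>'_def\<close>)
      also have "\<dots> \<le> \<epsilon> / 2"
        using B \<open>0 < \<epsilon>\<close> by (simp add: field_simps)
      finally show "B * (\<Sum>(u, v)\<in>I. v - u) \<le> \<epsilon> / 2" .
    qed
    finally show ?thesis by simp
  qed
  moreover have "0 < \<delta>'" using \<delta> B \<open>0 < \<epsilon>\<close> by (simp add: \<delta>'_def)
  ultimately show "\<exists>\<delta>>0. \<forall>I. finite I \<and> (\<forall>(u, v)\<in>I. a \<le> u \<and> u \<le> v \<and> v \<le> b) \<and>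
        pairwise (\<lambda>(u, v) (u', v'). disjnt {u<..<v} {u'<..<v'}) I \<and>
        (\<Sum>(u, v)\<in>I. v - u) < \<delta> \<longrightarrow> (\<Sum>(u, v)\<in>I. \<bar>(y v + h v) - (y u + h u)\<bar>) < \<epsilon>"
    by (intro exI[of _ \<delta>'] conjI allI impI) (assumption, elim conjE)
qed

lemma abs_continuous_on_interval_imp_continuous_on:
  assumes "abs_continuous_on_interval a b y"
  shows "continuous_on {a..b} y"
  unfolding continuous_on_iff
proof (intro ballI allI impI)
  fix x \<epsilon> :: real assume x: "x \<in> {a..b}" and "0 < \<epsilon>"
  obtain \<delta> where \<delta>: "0 < \<delta>" and
    \<delta>_y: "\<And>I. finite I \<Longrightarrow> (\<forall>(u, v)\<in>I. a \<le> u \<and> u \<le> v \<and> v \<le> b) \<Longrightarrow>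
        pairwise (\<lambda>(u, v) (u', v'). disjnt {u<..<v} {u'<..<v'}) I \<Longrightarrow>
        (\<Sum>(u, v)\<in>I. v - u) < \<delta> \<Longrightarrow> (\<Sum>(u, v)\<in>I. \<bar>y v - y u\<bar>) < \<epsilon>"
    by (rule abs_continuous_on_intervalE[OF assms \<open>0 < \<epsilon>\<close>], rule that)
  have "dist (y x') (y x) < \<epsilon>" if x': "x' \<in> {a..b}" "dist x' x < \<delta>" for x'
    using \<delta>_y[of "{(min x x', max x x')}"] x x'
    by (cases "x \<le> x'") (auto simp: dist_real_def min_def max_def)
  then show "\<exists>\<delta>>0. \<forall>x'\<in>{a..b}. dist x' x < \<delta> \<longrightarrow> dist (y x') (y x) < \<epsilon>"
    using \<delta> by blast
qed

lemma left_RL_integral_1_has_derivative: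
  fixes g :: "real \<Rightarrow> real"
  assumes g: "continuous_on {a..b} g" and t: "a < t" "t < b"
  shows "(left_RL_integral a 1 g has_real_derivative g t) (at t)"
proof -
  have "((\<lambda>x. integral {a..x} g) has_real_derivative g t) (at t within {a..b})"
    by (rule integral_has_real_derivative[OF g]) (use t in auto)
  then show ?thesis
    using t by (simp add: left_RL_integral_1[abs_def] at_within_Icc_at)
qed

lemma left_RL_integral_1_Lipschitz:
  fixes g :: "real \<Rightarrow> real"
  assumes g: "continuous_on {a..b} g"
  obtains B where "0 \<le> B"
    "\<And>u v. a \<le> u \<Longrightarrow> u \<le> v \<Longrightarrow> v \<le> b \<Longrightarrow> \<bar>left_RL_integral a 1 g v - left_RL_integral a 1 g u\<bar> \<le> B * (v - u)"
proof -
  obtain B where B: "0 < B" "\<And>t. t \<in> {a..b} \<Longrightarrow> \<bar>g t\<bar> \<le> B"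
    using compact_imp_bounded[OF compact_continuous_image[OF g compact_Icc]]
    unfolding bounded_pos by auto
  have "\<bar>left_RL_integral a 1 g v - left_RL_integral a 1 g u\<bar> \<le> B * (v - u)"
    if uv: "a \<le> u" "u \<le> v" "v \<le> b" for u v
  proof -
    have "g integrable_on {a..v}"
      by (rule integrable_continuous_real, rule continuous_on_subset[OF g]) (use uv in auto)
    from Henstock_Kurzweil_Integration.integral_combine[OF uv(1,2) this]
    have "left_RL_integral a 1 g v - left_RL_integral a 1 g u = integral {u..v} g"
      by (simp add: left_RL_integral_1)
    moreover have "norm (integral {u..v} g) \<le> B * (v - u)"
      by (rule integral_bound[OF uv(2)]) (use uv B(2) in \<open>auto intro: continuous_on_subset[OF g]\<close>)
    ultimately show ?thesis by simp
  qed
  with B(1) show thesis by (intro that[of B]) auto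
qed

text \<open>Off a negligible set \<open>deriv u\<close> is \<open>deriv y + g\<close>, and
  negligible sets change neither integrability nor integrals. The added primitive thus contributes
  an integral of \<open>g\<close> in which no derivative is left.\<close>

lemma left_Caputo_derivative_add:
  assumes g: "continuous_on {a..b} g" and \<alpha>: "\<alpha> < 1" and x: "x \<in> {a..b}"
    and y: "left_Caputo_derivative_exists a \<alpha> y x"
  defines "u \<equiv> \<lambda>t. y t + left_RL_integral a 1 g t"
  shows "left_Caputo_derivative_exists a \<alpha> u x"
    and "left_Caputo_derivative a \<alpha> u x = left_Caputo_derivative a \<alpha> y x + left_RL_integral a (1 - \<alpha>) g x"
proof -
  \<comment> \<open>\<open>deriv\<close> is two-sided, and the primitive is controlled only inside
    \<open>{a..b}\<close>. Removing \<open>a\<close> and \<open>x\<close>, where \<open>x\<close>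
    may equal \<open>b\<close>, confines \<open>t\<close> to the open interval.\<close>
  define N where "N = {t \<in> {a..x}. \<not> y differentiable (at t)} \<union> {a, x}"
  have N: "negligible N"
    using y unfolding N_def left_Caputo_derivative_exists_def
    by (intro negligible_Un) auto
  have D: "(u has_real_derivative (deriv y t + g t)) (at t)" if "t \<in> {a..x} - N" for t
  proof -
    have "y differentiable (at t)" and t: "a < t" "t < b" using that x unfolding N_def by auto
    then have "(y has_real_derivative deriv y t) (at t)"
      using DERIV_deriv_iff_real_differentiable by blast
    from DERIV_add[OF this left_RL_integral_1_has_derivative[OF g t]]
    show ?thesis unfolding u_def .
  qed
  have gx: "continuous_on {a..x} g" by (rule continuous_on_subset[OF g]) (use x in auto)
  have ky: "(\<lambda>t. (x - t) powr (- \<alpha>) * deriv y t) absolutely_integrable_on {a..x}"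
    using y unfolding left_Caputo_derivative_exists_def by blast
  have kg: "(\<lambda>t. (x - t) powr (- \<alpha>) * g t) absolutely_integrable_on {a..x}"
    using left_RL_kernel_integrable[OF _ gx, of "1 - \<alpha>"] \<alpha> by simp
  have ku: "(x - t) powr (- \<alpha>) * deriv u t = (x - t) powr (- \<alpha>) * deriv y t + (x - t) powr (- \<alpha>) * g t"
    if "t \<in> {a..x} - N" for t
    using DERIV_imp_deriv[OF D[OF that]] by (simp add: distrib_left)
  have "{t \<in> {a..x}. \<not> u differentiable (at t)} \<subseteq> N"
    using D real_differentiable_def by blast
  moreover have "(\<lambda>t. (x - t) powr (- \<alpha>) * deriv u t) absolutely_integrable_on {a..x}"
    by (rule absolutely_integrable_spike[OF set_integral_add(1)[OF ky kg] N]) (rule ku)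
  ultimately show "left_Caputo_derivative_exists a \<alpha> u x"
    unfolding left_Caputo_derivative_exists_def using N negligible_subset by blast
  have "integral {a..x} (\<lambda>t. (x - t) powr (- \<alpha>) * deriv u t)
      = integral {a..x} (\<lambda>t. (x - t) powr (- \<alpha>) * deriv y t + (x - t) powr (- \<alpha>) * g t)"
    by (rule integral_spike[OF N]) (simp add: ku)
  also have "\<dots> = integral {a..x} (\<lambda>t. (x - t) powr (- \<alpha>) * deriv y t)
      + integral {a..x} (\<lambda>t. (x - t) powr (- \<alpha>) * g t)"
    using ky kg by (intro Henstock_Kurzweil_Integration.integral_add) (auto simp: absolutely_integrable_on_def)
  finally show "left_Caputo_derivative a \<alpha> u x = left_Caputo_derivative a \<alpha> y x + left_RL_integral a (1 - \<alpha>) g x"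
    unfolding left_Caputo_derivative_def left_RL_integral_def by (simp add: add_divide_distrib)
qed

lemma frac_class_add:
  assumes y: "y \<in> frac_class a b \<alpha> \<beta>" and g: "continuous_on {a..b} g" and \<alpha>: "\<alpha> < 1" and \<beta>: "0 < \<beta>"
  defines "h \<equiv> left_RL_integral a 1 g"
  shows "(\<lambda>x. y x + h x) \<in> frac_class a b \<alpha> \<beta>"
    and "\<And>x. x \<in> {a..b} \<Longrightarrow> left_Caputo_derivative a \<alpha> (\<lambda>x. y x + h x) x
          = left_Caputo_derivative a \<alpha> y x + left_RL_integral a (1 - \<alpha>) g x"
    and "\<And>x. x \<in> {a..b} \<Longrightarrow> left_RL_integral a \<beta> (\<lambda>x. y x + h x) x
          = left_RL_integral a \<beta> y x + left_RL_integral a \<beta> h x"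
proof -
  have h: "continuous_on {a..b} h" unfolding h_def by (rule continuous_on_left_RL_integral[OF _ g]) simp
  have yp: "abs_continuous_on_interval a b y" "\<And>x. x \<in> {a..b} \<Longrightarrow> left_Caputo_derivative_exists a \<alpha> y x"
      "continuous_on {a..b} (left_Caputo_derivative a \<alpha> y)"
      "\<And>x. x \<in> {a..b} \<Longrightarrow> left_RL_integral_exists a \<beta> y x" "continuous_on {a..b} (left_RL_integral a \<beta> y)"
    using y unfolding frac_class_def by auto
  have ex_h: "left_RL_integral_exists a \<beta> h x" if "x \<in> {a..b}" for x
    unfolding left_RL_integral_exists_def
    by (rule left_RL_kernel_integrable[OF \<beta>], rule continuous_on_subset[OF h]) (use that in auto)
  show C: "left_Caputo_derivative a \<alpha> (\<lambda>x. y x + h x) x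
          = left_Caputo_derivative a \<alpha> y x + left_RL_integral a (1 - \<alpha>) g x" if "x \<in> {a..b}" for x
    unfolding h_def by (rule left_Caputo_derivative_add(2)[OF g \<alpha> that yp(2)[OF that]])
  show R: "left_RL_integral a \<beta> (\<lambda>x. y x + h x) x
          = left_RL_integral a \<beta> y x + left_RL_integral a \<beta> h x" if "x \<in> {a..b}" for x
    by (rule left_RL_integral_add[OF yp(4)[OF that] ex_h[OF that]])
  obtain B where "0 \<le> B" "\<And>u v. a \<le> u \<Longrightarrow> u \<le> v \<Longrightarrow> v \<le> b \<Longrightarrow> \<bar>h v - h u\<bar> \<le> B * (v - u)"
    using left_RL_integral_1_Lipschitz[OF g] unfolding h_def by blast
  from abs_continuous_on_interval_add_Lipschitz[OF yp(1) this]
  have 1: "abs_continuous_on_interval a b (\<lambda>x. y x + h x)" .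
  have 2: "left_Caputo_derivative_exists a \<alpha> (\<lambda>x. y x + h x) x" if "x \<in> {a..b}" for x
    unfolding h_def by (rule left_Caputo_derivative_add(1)[OF g \<alpha> that yp(2)[OF that]])
  have 3: "continuous_on {a..b} (left_Caputo_derivative a \<alpha> (\<lambda>x. y x + h x))"
    by (rule continuous_on_eq[OF continuous_on_add[OF yp(3) continuous_on_left_RL_integral[OF _ g, of "1 - \<alpha>"]]])
      (use \<alpha> C in auto)
  have 4: "left_RL_integral_exists a \<beta> (\<lambda>x. y x + h x) x" if "x \<in> {a..b}" for x
    using set_integral_add(1)[OF yp(4)[OF that, unfolded left_RL_integral_exists_def]
        ex_h[OF that, unfolded left_RL_integral_exists_def]]
    unfolding left_RL_integral_exists_def by (simp add: distrib_left)
  have 5: "continuous_on {a..b} (left_RL_integral a \<beta> (\<lambda>x. y x + h x))"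
    by (rule continuous_on_eq[OF continuous_on_add[OF yp(5) continuous_on_left_RL_integral[OF \<beta> h]]])
      (use R in auto)
  show "(\<lambda>x. y x + h x) \<in> frac_class a b \<alpha> \<beta>"
    unfolding frac_class_def using 1 2 3 4 5 by simp
qed

section \<open>Lagrange multipliers for one constraint\<close>

text \<open>If the derivative of \<open>(J, I)\<close> at \<open>0\<close> were surjective, then \<open>(J, I)\<close> would be locally open, so
  \<open>J\<close> could be decreased at constant \<open>I\<close>.\<close>

lemma constrained_minimum_dependent_derivatives:
  fixes J I :: "real \<times> real \<Rightarrow> real"
  assumes J: "\<And>e. (J has_derivative blinfun_apply (J' e)) (at e)"
    and I: "\<And>e. (I has_derivative blinfun_apply (I' e)) (at e)"
    and J0: "\<And>d. blinfun_apply (J' 0) d = fst d * j1 + snd d * j2"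
    and I0: "\<And>d. blinfun_apply (I' 0) d = fst d * i1 + snd d * i2"
    and min: "\<And>e. I e = I 0 \<Longrightarrow> J 0 \<le> J e"
  shows "j1 * i2 = j2 * i1"
proof (rule ccontr)
  assume ne: "j1 * i2 \<noteq> j2 * i1"
  define D where "D = j1 * i2 - j2 * i1"
  have D: "D \<noteq> 0" using ne by (simp add: D_def)
  define \<Phi> where "\<Phi> e = (J e, I e)" for e
  define \<Phi>' where "\<Phi>' d = (fst d * j1 + snd d * j2, fst d * i1 + snd d * i2)" for d :: "real \<times> real"
  \<comment> \<open>Cramer's rule: \<open>g\<close> is the inverse of the matrix with rows
    \<open>(j1, j2)\<close> and \<open>(i1, i2)\<close> and determinant \<open>D\<close>.\<close>
  define g where "g p = ((i2 * fst p - j2 * snd p) / D, (j1 * snd p - i1 * fst p) / D)" for p :: "real \<times> real"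
  have der: "(\<Phi> has_derivative (\<lambda>d. (J' e d, I' e d))) (at e)" for e
    unfolding \<Phi>_def by (intro has_derivative_Pair J I)
  have "\<Phi> 0 \<in> interior (\<Phi> ` UNIV)"
  \<comment> \<open>This form of the open mapping theorem asks for continuity of the map and, at the
    one point 0, for a derivative with a bounded linear right inverse.\<close>
  proof (rule sussmann_open_mapping)
    show "continuous_on UNIV \<Phi>"
      using der has_derivative_continuous by (metis continuous_at_imp_continuous_on)
    show "(\<Phi> has_derivative \<Phi>') (at 0)"
      using der[of 0] by (simp add: \<Phi>'_def[abs_def] J0 I0)
    show "bounded_linear g"
      unfolding g_def linear_conv_bounded_linear[symmetric]
      by (auto intro!: linearI simp: algebra_simps add_divide_distrib diff_divide_distrib)
    show "\<Phi>' \<circ> g = id"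
    proof
      fix p :: "real \<times> real"
      have "(i2 * fst p - j2 * snd p) * j1 + (j1 * snd p - i1 * fst p) * j2 = fst p * D"
        "(i2 * fst p - j2 * snd p) * i1 + (j1 * snd p - i1 * fst p) * i2 = snd p * D"
        unfolding D_def by algebra+
      then show "(\<Phi>' \<circ> g) p = id p"
        using D by (simp add: \<Phi>'_def g_def prod_eq_iff add_divide_distrib[symmetric])
    qed
  qed auto
  then obtain r where r: "0 < r" "ball (\<Phi> 0) r \<subseteq> \<Phi> ` UNIV"
    unfolding mem_interior by blast
  have "(J 0 - r / 2, I 0) \<in> ball (\<Phi> 0) r"
    using r by (simp add: \<Phi>_def dist_Pair_Pair dist_real_def)
  then obtain e where "J e = J 0 - r / 2" "I e = I 0"
    using r(2) unfolding \<Phi>_def by fastforce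
  then show False using min[of e] r(1) by simp
qed

text \<open>If \<open>T\<close> vanishes throughout, the pair (0, 1) works whatever \<open>S\<close>
  is; this is the abnormal case. Otherwise any \<open>k\<close> with \<open>T k\<close> nonzero
  fixes the ratio once and for all, and \<open>lam0 = T k\<close> is nonzero.\<close>

lemma dependent_functionals:
  fixes S T :: "'a \<Rightarrow> real"
  assumes dep: "\<And>g1 g2. P g1 \<Longrightarrow> P g2 \<Longrightarrow> S g1 * T g2 = S g2 * T g1"
  obtains lam0 lam where "\<not> (lam0 = 0 \<and> lam = 0)" "\<And>g. P g \<Longrightarrow> lam0 * S g - lam * T g = 0"
proof (cases "\<forall>g. P g \<longrightarrow> T g = 0")
  case True
  then show thesis using that[of 0 1] by simp
next
  case False
  then obtain k where k: "P k" "T k \<noteq> 0" by blast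
  show thesis
  proof (rule that[of "T k" "S k"])
    show "T k * S g - S k * T g = 0" if "P g" for g
      using dep[OF that k(1)] by (simp add: mult.commute)
  qed (use k in simp)
qed

subsection \<open>First variation and the Euler-Lagrange equation\<close>

lemma left_RL_integral_cong:
  "(\<And>t. t \<in> {a..x} \<Longrightarrow> f t = g t) \<Longrightarrow> left_RL_integral a \<mu> f x = left_RL_integral a \<mu> g x"
  unfolding left_RL_integral_def
  by (intro arg_cong[of _ _ "\<lambda>i. 1 / Gamma \<mu> * i"] Henstock_Kurzweil_Integration.integral_cong) simp

lemma left_RL_integral_linear_combination:
  fixes g1 g2 :: "real \<Rightarrow> real"
  assumes "0 < \<mu>" "continuous_on {a..x} g1" "continuous_on {a..x} g2"
  shows "left_RL_integral a \<mu> (\<lambda>t. c * g1 t + d * g2 t) x =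
    c * left_RL_integral a \<mu> g1 x + d * left_RL_integral a \<mu> g2 x"
proof -
  have "left_RL_integral_exists a \<mu> (\<lambda>t. c * g1 t) x" "left_RL_integral_exists a \<mu> (\<lambda>t. d * g2 t) x"
    unfolding left_RL_integral_exists_def
    by (intro left_RL_kernel_integrable assms continuous_on_mult continuous_on_const)+
  from left_RL_integral_add[OF this] show ?thesis
    by (simp only: left_RL_integral_cmult)
qed

lemma frac_classD:
  assumes "u \<in> frac_class a b \<alpha> \<beta>"
  shows "continuous_on {a..b} u" "continuous_on {a..b} (left_Caputo_derivative a \<alpha> u)"
    "continuous_on {a..b} (left_RL_integral a \<beta> u)"
  using assms unfolding frac_class_def by (auto intro: abs_continuous_on_interval_imp_continuous_on)

lemma continuous_on_path4:
  assumes "u \<in> frac_class a b \<alpha> \<beta>"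
  shows "continuous_on {a..b} (path4 a \<alpha> \<beta> u)"
  unfolding path4_def by (intro continuous_on_Pair continuous_on_id frac_classD[OF assms])

lemma continuous_on_path5:
  assumes u: "u \<in> frac_class a b \<alpha> \<beta>" and l: "continuous_on ({a..b} \<times> UNIV) l"
  shows "continuous_on {a..b} (path5 a \<alpha> \<beta> l u)"
proof -
  have "continuous_on {a..b} (\<lambda>t. l (path4 a \<alpha> \<beta> u t))"
    by (rule continuous_on_compose2[OF l continuous_on_path4[OF u]]) (auto simp: path4_def)
  then have "continuous_on {a..b} (indef_integral a \<alpha> \<beta> l u)"
    unfolding indef_integral_def by (intro indefinite_integral_continuous_1 integrable_continuous_real)
  then show ?thesis
    unfolding path5_def by (intro continuous_on_Pair continuous_on_id frac_classD[OF u])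
qed

lemma continuous_on_along_path4:
  assumes "u \<in> frac_class a b \<alpha> \<beta>" "continuous_on ({a..b} \<times> UNIV) f"
  shows "continuous_on {a..b} (\<lambda>x. f (path4 a \<alpha> \<beta> u x))"
  by (rule continuous_on_compose2[OF assms(2) continuous_on_path4[OF assms(1)]]) (auto simp: path4_def)

lemma continuous_on_along_path5:
  assumes "u \<in> frac_class a b \<alpha> \<beta>" "continuous_on ({a..b} \<times> UNIV) l" "continuous_on ({a..b} \<times> UNIV) f"
  shows "continuous_on {a..b} (\<lambda>x. f (path5 a \<alpha> \<beta> l u x))"
  by (rule continuous_on_compose2[OF assms(3) continuous_on_path5[OF assms(1,2)]]) (auto simp: path5_def)

lemma functional_linear_combination:
  assumes u: "u \<in> frac_class a b \<alpha> \<beta>" and l: "continuous_on ({a..b} \<times> UNIV) l"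
    and F: "continuous_on ({a..b} \<times> UNIV) F" and G: "continuous_on ({a..b} \<times> UNIV) G"
  shows "functional a b \<alpha> \<beta> l (\<lambda>p. c * F p - d * G p) u
    = c * functional a b \<alpha> \<beta> l F u - d * functional a b \<alpha> \<beta> l G u"
proof -
  have "integral {a..b} (\<lambda>x. c * F (path5 a \<alpha> \<beta> l u x) - d * G (path5 a \<alpha> \<beta> l u x))
      = integral {a..b} (\<lambda>x. c * F (path5 a \<alpha> \<beta> l u x)) - integral {a..b} (\<lambda>x. d * G (path5 a \<alpha> \<beta> l u x))"
    by (intro Henstock_Kurzweil_Integration.integral_diff integrable_continuous_real
        continuous_on_mult continuous_on_const continuous_on_along_path5[OF u l] F G)
  then show ?thesis
    unfolding functional_def by simp
qed

text \<open>The first variation of the functional at \<open>y\<close> in the direction of the primitive of \<open>g\<close> is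
  \<open>integral {a..b} (\<lambda>t. g t * variation_kernel a b \<alpha> \<beta> l F y t)\<close>.\<close>

definition variation_kernel ::
  "real \<Rightarrow> real \<Rightarrow> real \<Rightarrow> real \<Rightarrow> (real \<times> real \<times> real \<times> real \<Rightarrow> real)
     \<Rightarrow> (real \<times> real \<times> real \<times> real \<times> real \<Rightarrow> real) \<Rightarrow> (real \<Rightarrow> real) \<Rightarrow> real \<Rightarrow> real" where
  "variation_kernel a b \<alpha> \<beta> l F y =
    (let Y = path4 a \<alpha> \<beta> y; Z = path5 a \<alpha> \<beta> l y; M = (\<lambda>s. integral {s..b} (\<lambda>t. pd5_z F (Z t)))
     in (\<lambda>t. right_RL_integral b 1 (\<lambda>s. (pd5_y F (Z s) + M s * pd4_y l (Y s))
              + right_RL_integral b \<beta> (\<lambda>s. pd5_w F (Z s) + M s * pd4_w l (Y s)) s) t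
          + right_RL_integral b (1 - \<alpha>) (\<lambda>s. pd5_v F (Z s) + M s * pd4_v l (Y s)) t))"

text \<open>Linearity of the left integrals makes \<open>u e\<close>, its Caputo derivative and its
  integral of order \<beta> affine in \<open>e\<close> on \<open>{a..b}\<close>, which is the shape
  of the abstract family. The resulting \<open>T\<close> is rewritten by
  \<open>first_variation_eq\<close>, so the direction appears only as a factor
  \<open>g\<close>.\<close>

lemma functional_has_derivative:
  assumes ab: "a < b" and \<alpha>: "\<alpha> < 1" and \<beta>: "0 < \<beta>" and y: "y \<in> frac_class a b \<alpha> \<beta>"
    and F: "C1_on F ({a..b} \<times> UNIV)" and l: "C1_on l ({a..b} \<times> UNIV)"
    and g1: "continuous_on {a..b} g1" and g2: "continuous_on {a..b} g2"
  defines "u \<equiv> \<lambda>(e::real \<times> real) x. y x + left_RL_integral a 1 (\<lambda>t. fst e * g1 t + snd e * g2 t) x"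
  defines "S \<equiv> \<lambda>g. integral {a..b} (\<lambda>t. g t * variation_kernel a b \<alpha> \<beta> l F y t)"
  obtains J' :: "real \<times> real \<Rightarrow> (real \<times> real) \<Rightarrow>\<^sub>L real"
  where "\<And>e. ((\<lambda>e. functional a b \<alpha> \<beta> l F (u e)) has_derivative blinfun_apply (J' e)) (at e)"
    "\<And>d. blinfun_apply (J' 0) d = fst d * S g1 + snd d * S g2"
proof -
  define v where "v = left_Caputo_derivative a \<alpha> y"
  define w where "w = left_RL_integral a \<beta> y"
  define h where "h g = left_RL_integral a 1 g" for g
  define k where "k g = left_RL_integral a (1 - \<alpha>) g" for g
  define m where "m g = left_RL_integral a \<beta> (h g)" for g
  have \<mu>: "0 < 1 - \<alpha>" and one: "(0::real) < 1" using \<alpha> by simp_all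
  have h: "continuous_on {a..b} (h g)" and k: "continuous_on {a..b} (k g)" and m: "continuous_on {a..b} (m g)"
    if "continuous_on {a..b} g" for g
    unfolding h_def k_def m_def by (intro continuous_on_left_RL_integral \<mu> one \<beta> that)+
  have sub: "continuous_on {a..x} f" if "continuous_on {a..b} f" "x \<in> {a..b}" for f :: "real \<Rightarrow> real" and x
    by (rule continuous_on_subset[OF that(1)]) (use that(2) in auto)
  have comb: "continuous_on {a..b} (\<lambda>t. fst e * g1 t + snd e * g2 t)" for e :: "real \<times> real"
    by (intro continuous_on_add continuous_on_mult continuous_on_const g1 g2)
  have lin: "left_RL_integral a \<mu> (\<lambda>t. fst e * f1 t + snd e * f2 t) x
      = fst e * left_RL_integral a \<mu> f1 x + snd e * left_RL_integral a \<mu> f2 x"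
    if "0 < \<mu>" "x \<in> {a..b}" "continuous_on {a..b} f1" "continuous_on {a..b} f2"
    for \<mu> x f1 f2 and e :: "real \<times> real"
    by (rule left_RL_integral_linear_combination[OF that(1) sub[OF that(3,2)] sub[OF that(4,2)]])
  have u1: "u e x = y x + (fst e * h g1 x + snd e * h g2 x)" if "x \<in> {a..b}" for e x
    unfolding u_def h_def by (simp only: lin[OF one that g1 g2])
  have u2: "left_Caputo_derivative a \<alpha> (u e) x = v x + (fst e * k g1 x + snd e * k g2 x)" if "x \<in> {a..b}" for e x
    unfolding u_def frac_class_add(2)[OF y comb \<alpha> \<beta> that] v_def k_def lin[OF \<mu> that g1 g2] ..
  have u3: "left_RL_integral a \<beta> (u e) x = w x + (fst e * m g1 x + snd e * m g2 x)" if x: "x \<in> {a..b}" for e x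
  proof -
    have "left_RL_integral a \<beta> (left_RL_integral a 1 (\<lambda>t. fst e * g1 t + snd e * g2 t)) x
        = left_RL_integral a \<beta> (\<lambda>t. fst e * h g1 t + snd e * h g2 t) x"
      unfolding h_def by (rule left_RL_integral_cong, rule lin[OF one _ g1 g2]) (use x in auto)
    then show ?thesis
      unfolding u_def frac_class_add(3)[OF y comb \<alpha> \<beta> that] w_def m_def
      by (simp only: lin[OF \<beta> x h[OF g1] h[OF g2]])
  qed
  define Q where "Q = (\<lambda>(e::real \<times> real) t. (t, y t + (fst e * h g1 t + snd e * h g2 t),
      v t + (fst e * k g1 t + snd e * k g2 t), w t + (fst e * m g1 t + snd e * m g2 t)))"
  define P where "P = (\<lambda>(e::real \<times> real) x. (x, y x + (fst e * h g1 x + snd e * h g2 x),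
      v x + (fst e * k g1 x + snd e * k g2 x), w x + (fst e * m g1 x + snd e * m g2 x),
      integral {a..x} (\<lambda>t. l (Q e t))))"
  define T where "T = (\<lambda>h k m. integral {a..b} (\<lambda>x.
      pd5_y F (P 0 x) * h x + pd5_v F (P 0 x) * k x + pd5_w F (P 0 x) * m x
      + pd5_z F (P 0 x) * integral {a..x} (\<lambda>t.
          pd4_y l (Q 0 t) * h t + pd4_v l (Q 0 t) * k t + pd4_w l (Q 0 t) * m t)))"
  note yD = frac_classD[OF y, folded v_def w_def]
  obtain J' :: "real \<times> real \<Rightarrow> (real \<times> real) \<Rightarrow>\<^sub>L real"
    where J': "\<And>e. ((\<lambda>e. integral {a..b} (\<lambda>x. F (P e x))) has_derivative blinfun_apply (J' e)) (at e)"
    "\<And>d. blinfun_apply (J' 0) d = fst d * T (h g1) (k g1) (m g1) + snd d * T (h g2) (k g2) (m g2)"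
    unfolding T_def P_def Q_def
    by (rule functional_family_has_derivative[OF less_imp_le[OF ab] F l
        yD(1) h[OF g1] h[OF g2] yD(2) k[OF g1] k[OF g2] yD(3) m[OF g1] m[OF g2]],
        rule that[unfolded T_def P_def Q_def])
  have path4_eq: "path4 a \<alpha> \<beta> (u e) t = Q e t" if "t \<in> {a..b}" for e t
    unfolding path4_def Q_def using that by (simp only: u1 u2 u3)
  have path5_eq: "path5 a \<alpha> \<beta> l (u e) x = P e x" if x: "x \<in> {a..b}" for e x
  proof -
    have "indef_integral a \<alpha> \<beta> l (u e) x = integral {a..x} (\<lambda>t. l (Q e t))"
      unfolding indef_integral_def
      by (rule Henstock_Kurzweil_Integration.integral_cong, rule arg_cong[of _ _ l], rule path4_eq) (use x in auto)
    then show ?thesis unfolding path5_def P_def using x by (simp only: u1 u2 u3)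
  qed
  have fun_eq: "functional a b \<alpha> \<beta> l F (u e) = integral {a..b} (\<lambda>x. F (P e x))" for e
    unfolding functional_def
    by (rule Henstock_Kurzweil_Integration.integral_cong, rule arg_cong[of _ _ F], rule path5_eq)
  have Q0: "Q 0 = path4 a \<alpha> \<beta> y"
    by (simp add: fun_eq_iff Q_def path4_def v_def w_def)
  have P0: "P 0 = path5 a \<alpha> \<beta> l y"
    by (simp add: fun_eq_iff P_def Q0 path5_def indef_integral_def v_def w_def)
  note cl = C1_on_imp_continuous_on[OF l]
  have T_eq: "T (h g) (k g) (m g) = S g" if g: "continuous_on {a..b} g" for g
    unfolding T_def S_def P0 Q0 variation_kernel_def Let_def h_def k_def m_def
    by (rule first_variation_eq[OF \<mu> \<beta> g])
      (intro continuous_on_along_path5[OF y cl] continuous_on_along_path4[OF y]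
        continuous_on_pd5[OF F] continuous_on_pd4[OF l])+
  show thesis
  proof (rule that)
    show "((\<lambda>e. functional a b \<alpha> \<beta> l F (u e)) has_derivative blinfun_apply (J' e)) (at e)" for e
      unfolding fun_eq by (rule J'(1))
    show "blinfun_apply (J' 0) d = fst d * S g1 + snd d * S g2" for d
      unfolding J'(2) T_eq[OF g1] T_eq[OF g2] ..
  qed
qed

section \<open>The right fractional derivative\<close>

text \<open>The hypothesis solves for the integral of order \<open>1 - \<alpha>\<close> of
  \<open>B\<close>: it is a constant minus the integral of \<open>q\<close> over
  \<open>{x..b}\<close>. This is differentiable because \<open>q\<close> is continuous, although
  \<open>B\<close> is merely continuous itself.\<close>

lemma right_RL_derivative_eqI:
  fixes B :: "real \<Rightarrow> real"
  assumes ab: "a < b" and \<alpha>: "\<alpha> < 1" and B: "continuous_on {a..b} B" and q: "continuous_on {a..b} q"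
    and eq: "\<And>x. x \<in> {a..b} \<Longrightarrow> right_RL_integral b 1 q x + right_RL_integral b (1 - \<alpha>) B x = c"
    and x: "x \<in> {a..b}"
  shows "right_RL_derivative_exists a b \<alpha> B x" "right_RL_derivative a b \<alpha> B x = - q x"
proof -
  define \<phi> where "\<phi> s = integral {s..b} (\<lambda>t. (t - s) powr (- \<alpha>) * B t)" for s
  have \<Gamma>: "0 < Gamma (1 - \<alpha>)" using \<alpha> by simp
  have q_int: "q integrable_on {a..b}" by (rule integrable_continuous_real[OF q])
  have \<phi>: "\<phi> s = Gamma (1 - \<alpha>) * (c - integral {a..b} q + integral {a..s} q)" if s: "s \<in> {a..b}" for s
  proof -
    have \<phi>_eq: "\<phi> s = Gamma (1 - \<alpha>) * right_RL_integral b (1 - \<alpha>) B s"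
      using \<Gamma> by (simp add: \<phi>_def right_RL_integral_def)
    from Henstock_Kurzweil_Integration.integral_combine[OF _ _ q_int] s
    have "integral {a..s} q + integral {s..b} q = integral {a..b} q"
      by auto
    moreover have "integral {s..b} q + right_RL_integral b (1 - \<alpha>) B s = c"
      using eq[OF s] unfolding right_RL_integral_1 .
    ultimately have "right_RL_integral b (1 - \<alpha>) B s = c - integral {a..b} q + integral {a..s} q"
      by linarith
    then show ?thesis using \<phi>_eq by simp
  qed
  have "((\<lambda>s. Gamma (1 - \<alpha>) * (c - integral {a..b} q + integral {a..s} q))
      has_real_derivative Gamma (1 - \<alpha>) * q x) (at x within {a..b})"
    using integral_has_real_derivative[OF q x] by (auto intro!: derivative_eq_intros)
  then have \<psi>: "((\<lambda>s. Gamma (1 - \<alpha>) * (c - integral {a..b} q + integral {a..s} q))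
      has_vector_derivative Gamma (1 - \<alpha>) * q x) (at x within {a..b})"
    unfolding has_real_derivative_iff_has_vector_derivative .
  \<comment> \<open>The formula for \<open>\<phi>\<close> holds on \<open>{a..b}\<close> only, so
    the derivative is taken within this interval and is one-sided at its end points, as in
    \<open>right_RL_derivative\<close>.\<close>
  have D: "(\<phi> has_vector_derivative Gamma (1 - \<alpha>) * q x) (at x within {a..b})"
    by (rule has_vector_derivative_transform[OF x \<phi> \<psi>])
  have int: "(\<lambda>t. (t - s) powr (- \<alpha>) * B t) absolutely_integrable_on {s..b}" if "s \<in> {a..b}" for s
    using right_RL_kernel_integrable[of "1 - \<alpha>" s b B] \<alpha> continuous_on_subset[OF B, of "{s..b}"] that by simp
  show "right_RL_derivative_exists a b \<alpha> B x"
    unfolding right_RL_derivative_exists_def using int D unfolding \<phi>_def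
    by (auto intro: differentiableI_vector)
  have "vector_derivative \<phi> (at x within {a..b}) = Gamma (1 - \<alpha>) * q x"
    by (rule vector_derivative_within_closed_interval[OF ab x D])
  then show "right_RL_derivative a b \<alpha> B x = - q x"
    unfolding right_RL_derivative_def \<phi>_def using \<Gamma> by simp
qed

text \<open>The integrals always add up, so the one for \<open>f2\<close> is a difference of two
  differentiable functions. Existence for one summand thus forces it for the other.\<close>

lemma right_RL_derivative_split:
  fixes f1 f2 :: "real \<Rightarrow> real"
  assumes ab: "a < b" and \<alpha>: "\<alpha> < 1" and x: "x \<in> {a..b}"
    and f1: "continuous_on {a..b} f1" and f2: "continuous_on {a..b} f2"
    and ex: "right_RL_derivative_exists a b \<alpha> (\<lambda>s. f1 s + f2 s) x" and ex1: "right_RL_derivative_exists a b \<alpha> f1 x"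
  shows "right_RL_derivative_exists a b \<alpha> f2 x"
    "right_RL_derivative a b \<alpha> (\<lambda>s. f1 s + f2 s) x = right_RL_derivative a b \<alpha> f1 x + right_RL_derivative a b \<alpha> f2 x"
proof -
  define \<phi> where "\<phi> f s = integral {s..b} (\<lambda>t. (t - s) powr (- \<alpha>) * f t)" for f :: "real \<Rightarrow> real" and s
  define D where "D f = vector_derivative (\<phi> f) (at x within {a..b})" for f
  have int: "(\<lambda>t. (t - s) powr (- \<alpha>) * f t) absolutely_integrable_on {s..b}"
    if "s \<in> {a..b}" "continuous_on {a..b} f" for s f
    using right_RL_kernel_integrable[of "1 - \<alpha>" s b f] \<alpha> continuous_on_subset[OF that(2), of "{s..b}"] that(1) by simp
  have \<phi>: "\<phi> f2 s = \<phi> (\<lambda>s. f1 s + f2 s) s - \<phi> f1 s" if s: "s \<in> {a..b}" for s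
    using int[OF s f1] int[OF s f2]
    by (simp add: \<phi>_def distrib_left absolutely_integrable_on_def Henstock_Kurzweil_Integration.integral_add)
  have "(\<phi> (\<lambda>s. f1 s + f2 s) has_vector_derivative D (\<lambda>s. f1 s + f2 s)) (at x within {a..b})"
    "(\<phi> f1 has_vector_derivative D f1) (at x within {a..b})"
    using ex ex1 unfolding right_RL_derivative_exists_def D_def vector_derivative_works[symmetric] \<phi>_def by auto
  note \<psi> = has_vector_derivative_diff[OF this]
  have der: "(\<phi> f2 has_vector_derivative D (\<lambda>s. f1 s + f2 s) - D f1) (at x within {a..b})"
    by (rule has_vector_derivative_transform[OF x \<phi> \<psi>])
  then show "right_RL_derivative_exists a b \<alpha> f2 x"
    unfolding right_RL_derivative_exists_def using int f2 unfolding \<phi>_def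
    by (auto intro: differentiableI_vector)
  have D2: "D f2 = D (\<lambda>s. f1 s + f2 s) - D f1"
    unfolding D_def[of f2] by (rule vector_derivative_within_closed_interval[OF ab x der])
  show "right_RL_derivative a b \<alpha> (\<lambda>s. f1 s + f2 s) x = right_RL_derivative a b \<alpha> f1 x + right_RL_derivative a b \<alpha> f2 x"
    unfolding right_RL_derivative_def \<phi>_def[symmetric] D_def[symmetric] D2
    by (simp add: diff_divide_distrib)
qed

lemma C1_on_continuous_pd:
  assumes u: "u \<in> frac_class a b \<alpha> \<beta>" and l: "C1_on l ({a..b} \<times> UNIV)" and K: "C1_on K ({a..b} \<times> UNIV)"
  defines "Y \<equiv> path4 a \<alpha> \<beta> u" and "Z \<equiv> path5 a \<alpha> \<beta> l u"
  defines "M \<equiv> \<lambda>s. integral {s..b} (\<lambda>t. pd5_z K (Z t))"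
  shows "continuous_on {a..b} (\<lambda>s. pd5_y K (Z s))" "continuous_on {a..b} (\<lambda>s. pd5_v K (Z s))"
    "continuous_on {a..b} (\<lambda>s. pd5_w K (Z s))" "continuous_on {a..b} (\<lambda>s. M s * pd4_y l (Y s))"
    "continuous_on {a..b} (\<lambda>s. M s * pd4_v l (Y s))" "continuous_on {a..b} (\<lambda>s. M s * pd4_w l (Y s))"
proof -
  note cK = continuous_on_along_path5[OF u C1_on_imp_continuous_on[OF l]]
  note cl = continuous_on_along_path4[OF u]
  show "continuous_on {a..b} (\<lambda>s. pd5_y K (Z s))" "continuous_on {a..b} (\<lambda>s. pd5_v K (Z s))"
    "continuous_on {a..b} (\<lambda>s. pd5_w K (Z s))"
    unfolding Z_def by (intro cK continuous_on_pd5[OF K])+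
  have z: "continuous_on {a..b} (\<lambda>s. pd5_z K (Z s))"
    unfolding Z_def by (intro cK continuous_on_pd5[OF K])
  have "M = right_RL_integral b 1 (\<lambda>s. pd5_z K (Z s))"
    unfolding M_def by (simp add: fun_eq_iff right_RL_integral_1)
  then have M: "continuous_on {a..b} M"
    using continuous_on_right_RL_integral[OF _ z, of 1] by simp
  show "continuous_on {a..b} (\<lambda>s. M s * pd4_y l (Y s))"
    "continuous_on {a..b} (\<lambda>s. M s * pd4_v l (Y s))" "continuous_on {a..b} (\<lambda>s. M s * pd4_w l (Y s))"
    unfolding Y_def by (intro continuous_on_mult M cl continuous_on_pd4[OF l])+
qed

text \<open>Mean zero of \<open>g\<close> makes its primitive vanish at \<open>b\<close>, so all
  varied functions keep the boundary values and only the constraint decides admissibility.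
  Dependence for every pair of directions then gives one pair of multipliers valid for all of
  them.\<close>

lemma exists_multipliers:
  assumes ab: "a < b" and \<alpha>: "\<alpha> < 1" and \<beta>: "0 < \<beta>"
    and L: "C1_on L ({a..b} \<times> UNIV)" and G: "C1_on G ({a..b} \<times> UNIV)" and l: "C1_on l ({a..b} \<times> UNIV)"
    and adm: "y \<in> admissible a b \<alpha> \<beta> l G ya yb \<gamma>"
    and min: "\<forall>u \<in> admissible a b \<alpha> \<beta> l G ya yb \<gamma>.
           functional a b \<alpha> \<beta> l L y \<le> functional a b \<alpha> \<beta> l L u"
  obtains lam0 lam where "\<not> (lam0 = 0 \<and> lam = 0)"
    "\<And>g. continuous_on {a..b} g \<Longrightarrow> integral {a..b} g = 0 \<Longrightarrow>
      integral {a..b} (\<lambda>t. g t * variation_kernel a b \<alpha> \<beta> l (\<lambda>p. lam0 * L p - lam * G p) y t) = 0"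
proof -
  have y: "y \<in> frac_class a b \<alpha> \<beta>" and bd: "y a = ya" "y b = yb" and Gy: "functional a b \<alpha> \<beta> l G y = \<gamma>"
    using adm unfolding admissible_def by auto
  define u where "u g1 g2 = (\<lambda>(e::real \<times> real) x.
    y x + left_RL_integral a 1 (\<lambda>t. fst e * g1 t + snd e * g2 t) x)" for g1 g2
  define S where "S F g = integral {a..b} (\<lambda>t. g t * variation_kernel a b \<alpha> \<beta> l F y t)" for F g
  define X where "X g \<longleftrightarrow> continuous_on {a..b} g \<and> integral {a..b} g = 0" for g :: "real \<Rightarrow> real"
  have comb: "continuous_on {a..b} (\<lambda>t. fst e * g1 t + snd e * g2 t)"
    if "X g1" "X g2" for g1 g2 and e :: "real \<times> real"
    using that unfolding X_def by (intro continuous_on_add continuous_on_mult continuous_on_const) auto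
  have u_class: "u g1 g2 e \<in> frac_class a b \<alpha> \<beta>" if "X g1" "X g2" for g1 g2 e
    unfolding u_def by (rule frac_class_add(1)[OF y comb[OF that] \<alpha> \<beta>])
  have u0: "u g1 g2 0 = y" for g1 g2
    by (simp add: u_def left_RL_integral_1 fun_eq_iff)
  have u_a: "u g1 g2 e a = ya" for g1 g2 e
    by (simp add: u_def left_RL_integral_1 bd)
  have u_b: "u g1 g2 e b = yb" if "X g1" "X g2" for g1 g2 e
  proof -
    have "left_RL_integral a 1 (\<lambda>t. fst e * g1 t + snd e * g2 t) b
        = fst e * left_RL_integral a 1 g1 b + snd e * left_RL_integral a 1 g2 b"
      by (rule left_RL_integral_linear_combination) (use that in \<open>auto simp: X_def\<close>)
    then show ?thesis using that by (simp add: u_def left_RL_integral_1 X_def bd)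
  qed
  have var: thesis
    if "C1_on F ({a..b} \<times> UNIV)" "X g1" "X g2"
      "\<And>J'. (\<And>e. ((\<lambda>e. functional a b \<alpha> \<beta> l F (u g1 g2 e)) has_derivative blinfun_apply (J' e)) (at e)) \<Longrightarrow>
        (\<And>d. blinfun_apply (J' 0) d = fst d * S F g1 + snd d * S F g2) \<Longrightarrow> thesis"
    for F g1 g2 thesis
    by (rule functional_has_derivative[OF ab \<alpha> \<beta> y that(1) l, of g1 g2])
      (use that in \<open>unfold u_def S_def X_def, blast+\<close>)
  have "S L g1 * S G g2 = S L g2 * S G g1" if X: "X g1" "X g2" for g1 g2
  proof (rule var[OF L X], rule var[OF G X])
    fix J' I' assume J': "\<And>e. ((\<lambda>e. functional a b \<alpha> \<beta> l L (u g1 g2 e)) has_derivative blinfun_apply (J' e)) (at e)"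
        "\<And>d. blinfun_apply (J' 0) d = fst d * S L g1 + snd d * S L g2"
      and I': "\<And>e. ((\<lambda>e. functional a b \<alpha> \<beta> l G (u g1 g2 e)) has_derivative blinfun_apply (I' e)) (at e)"
        "\<And>d. blinfun_apply (I' 0) d = fst d * S G g1 + snd d * S G g2"
    show ?thesis
    proof (rule constrained_minimum_dependent_derivatives[OF J'(1) I'(1) J'(2) I'(2)])
      fix e assume "functional a b \<alpha> \<beta> l G (u g1 g2 e) = functional a b \<alpha> \<beta> l G (u g1 g2 0)"
      then have "u g1 g2 e \<in> admissible a b \<alpha> \<beta> l G ya yb \<gamma>"
        unfolding admissible_def using u_class[OF X] u_a u_b[OF X] by (simp add: u0 Gy)
      then show "functional a b \<alpha> \<beta> l L (u g1 g2 0) \<le> functional a b \<alpha> \<beta> l L (u g1 g2 e)"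
        using min by (simp add: u0)
    qed
  qed
  note dep = this
  obtain lam0 lam where nz: "\<not> (lam0 = 0 \<and> lam = 0)" and dep: "\<And>g. X g \<Longrightarrow> lam0 * S L g - lam * S G g = 0"
    by (rule dependent_functionals[of X "S L" "S G", OF dep], assumption, assumption, rule that)
  \<comment> \<open>Linearity of the first variation in the integrand is not computed from the
    kernel. The three functionals are differentiated along the same family with
    \<open>g1 = g2 = g\<close>; they are linear in the integrand, so uniqueness of the derivative,
    tested on \<open>(1, 0)\<close>, transfers the relation to \<open>S\<close>.\<close>
  have "S (\<lambda>p. lam0 * L p - lam * G p) g = 0" if g: "X g" for g
  proof (rule var[OF L g g], rule var[OF G g g], rule var[OF C1_on_linear_combination[OF L G, of lam0 lam] g g])
    fix J' I' K'
    assume J': "\<And>e. ((\<lambda>e. functional a b \<alpha> \<beta> l L (u g g e)) has_derivative blinfun_apply (J' e)) (at e)"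
        "\<And>d. blinfun_apply (J' 0) d = fst d * S L g + snd d * S L g"
      and I': "\<And>e. ((\<lambda>e. functional a b \<alpha> \<beta> l G (u g g e)) has_derivative blinfun_apply (I' e)) (at e)"
        "\<And>d. blinfun_apply (I' 0) d = fst d * S G g + snd d * S G g"
      and K': "\<And>e. ((\<lambda>e. functional a b \<alpha> \<beta> l (\<lambda>p. lam0 * L p - lam * G p) (u g g e))
          has_derivative blinfun_apply (K' e)) (at e)"
        "\<And>d. blinfun_apply (K' 0) d = fst d * S (\<lambda>p. lam0 * L p - lam * G p) g + snd d * S (\<lambda>p. lam0 * L p - lam * G p) g"
    have "((\<lambda>e. functional a b \<alpha> \<beta> l (\<lambda>p. lam0 * L p - lam * G p) (u g g e)) has_derivative
        (\<lambda>d. lam0 * J' 0 d - lam * I' 0 d)) (at 0)"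
      unfolding functional_linear_combination[OF u_class[OF g g] C1_on_imp_continuous_on[OF l]
        C1_on_imp_continuous_on[OF L] C1_on_imp_continuous_on[OF G]]
      by (intro has_derivative_diff has_derivative_mult_right J'(1) I'(1))
    from has_derivative_unique[OF K'(1) this]
    have "blinfun_apply (K' 0) (1, 0) = lam0 * J' 0 (1, 0) - lam * I' 0 (1, 0)"
      by simp
    then show ?thesis
      using dep[OF g] by (simp add: J'(2) I'(2) K'(2))
  qed
  then show thesis
    by (intro that[OF nz]) (simp add: S_def X_def)
qed

text \<open>The two terms under the right derivative are continuous, which does not ensure that each
  has such a derivative; only their sum is controlled by du Bois-Reymond's lemma. The first conjunct
  therefore applies the operator to the sum. The second gives the equation with separate terms
  wherever either derivative exists.\<close>

theorem theorem15:
  fixes a b \<alpha> \<beta> ya yb \<gamma> :: real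
    and L G :: "real \<times> real \<times> real \<times> real \<times> real \<Rightarrow> real"
    and l :: "real \<times> real \<times> real \<times> real \<Rightarrow> real"
    and y :: "real \<Rightarrow> real"
  assumes "a < b" and "0 < \<alpha>" and "\<alpha> < 1" and "0 < \<beta>"
    and "C1_on L ({a..b} \<times> UNIV)" and "C1_on G ({a..b} \<times> UNIV)" and "C1_on l ({a..b} \<times> UNIV)"
    and "y \<in> admissible a b \<alpha> \<beta> l G ya yb \<gamma>"
    and "\<forall>u \<in> admissible a b \<alpha> \<beta> l G ya yb \<gamma>.
           functional a b \<alpha> \<beta> l L y \<le> functional a b \<alpha> \<beta> l L u"
  shows "\<exists>lam0 lam :: real. \<not> (lam0 = 0 \<and> lam = 0) \<and>
    (let K = (\<lambda>p. lam0 * L p - lam * G p);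
         Y = path4 a \<alpha> \<beta> y;
         Z = path5 a \<alpha> \<beta> l y;
         M = (\<lambda>x. integral {x..b} (\<lambda>t. pd5_z K (Z t)));
         D = right_RL_derivative a b \<alpha>;
         D_exists = right_RL_derivative_exists a b \<alpha>;
         I = right_RL_integral b \<beta>
     in
       (\<forall>x\<in>{a..b}.
          D_exists (\<lambda>s. pd5_v K (Z s) + M s * pd4_v l (Y s)) x \<and>
          pd5_y K (Z x)
            + D (\<lambda>s. pd5_v K (Z s) + M s * pd4_v l (Y s)) x
            + I (\<lambda>s. pd5_w K (Z s)) x
            + M x * pd4_y l (Y x)
            + I (\<lambda>s. M s * pd4_w l (Y s)) x = 0) \<and>
       (\<forall>x\<in>{a..b}.
          D_exists (\<lambda>s. pd5_v K (Z s)) x \<or> D_exists (\<lambda>s. M s * pd4_v l (Y s)) x \<longrightarrow>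
          D_exists (\<lambda>s. pd5_v K (Z s)) x \<and> D_exists (\<lambda>s. M s * pd4_v l (Y s)) x \<and>
          pd5_y K (Z x)
            + D (\<lambda>s. pd5_v K (Z s)) x
            + I (\<lambda>s. pd5_w K (Z s)) x
            + M x * pd4_y l (Y x)
            + D (\<lambda>s. M s * pd4_v l (Y s)) x
            + I (\<lambda>s. M s * pd4_w l (Y s)) x = 0))"
proof -
  have \<mu>: "0 < 1 - \<alpha>" and one: "(0::real) < 1" using assms(3) by simp_all
  have y: "y \<in> frac_class a b \<alpha> \<beta>" using assms(8) unfolding admissible_def by simp
  obtain lam0 lam where nz: "\<not> (lam0 = 0 \<and> lam = 0)" and
    orth: "\<And>g. continuous_on {a..b} g \<Longrightarrow> integral {a..b} g = 0 \<Longrightarrow>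
      integral {a..b} (\<lambda>t. g t * variation_kernel a b \<alpha> \<beta> l (\<lambda>p. lam0 * L p - lam * G p) y t) = 0"
    by (rule exists_multipliers[OF assms(1,3-9)], rule that)
  define K where "K = (\<lambda>p. lam0 * L p - lam * G p)"
  define Y where "Y = path4 a \<alpha> \<beta> y"
  define Z where "Z = path5 a \<alpha> \<beta> l y"
  define M where "M = (\<lambda>x. integral {x..b} (\<lambda>t. pd5_z K (Z t)))"
  define B1 where "B1 = (\<lambda>s. pd5_v K (Z s))"
  define B2 where "B2 = (\<lambda>s. M s * pd4_v l (Y s))"
  define C1 where "C1 = (\<lambda>s. pd5_w K (Z s))"
  define C2 where "C2 = (\<lambda>s. M s * pd4_w l (Y s))"
  \<comment> \<open>\<open>q\<close> collects all that stands outside the right derivative. The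
    kernel is then the integral of \<open>q\<close> over \<open>{t..b}\<close> plus the integral of
    order \<open>1 - \<alpha>\<close> of \<open>B1 + B2\<close>, and the equation says that the
    right derivative of \<open>B1 + B2\<close> is \<open>- q\<close>.\<close>
  define q where "q = (\<lambda>s. (pd5_y K (Z s) + M s * pd4_y l (Y s)) + right_RL_integral b \<beta> (\<lambda>s. C1 s + C2 s) s)"
  have C1_K: "C1_on K ({a..b} \<times> UNIV)"
    unfolding K_def by (rule C1_on_linear_combination[OF assms(5,6)])
  have cont: "continuous_on {a..b} (\<lambda>s. pd5_y K (Z s))" "continuous_on {a..b} B1" "continuous_on {a..b} C1"
    "continuous_on {a..b} (\<lambda>s. M s * pd4_y l (Y s))" "continuous_on {a..b} B2" "continuous_on {a..b} C2"
    unfolding B1_def B2_def C1_def C2_def M_def Y_def Z_def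
    by (rule C1_on_continuous_pd[OF y assms(7) C1_K])+
  have B: "continuous_on {a..b} (\<lambda>s. B1 s + B2 s)" and C: "continuous_on {a..b} (\<lambda>s. C1 s + C2 s)"
    by (intro continuous_on_add cont)+
  have q: "continuous_on {a..b} q"
    unfolding q_def by (intro continuous_on_add continuous_on_right_RL_integral[OF assms(4) C] cont)
  have W: "variation_kernel a b \<alpha> \<beta> l K y
      = (\<lambda>t. right_RL_integral b 1 q t + right_RL_integral b (1 - \<alpha>) (\<lambda>s. B1 s + B2 s) t)"
    unfolding variation_kernel_def Let_def q_def B1_def B2_def C1_def C2_def M_def Y_def Z_def ..
  have W_cont: "continuous_on {a..b} (variation_kernel a b \<alpha> \<beta> l K y)"
    unfolding W by (intro continuous_on_add continuous_on_right_RL_integral[OF one q] continuous_on_right_RL_integral[OF \<mu> B])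
  obtain c where c: "\<And>x. x \<in> {a..b} \<Longrightarrow> variation_kernel a b \<alpha> \<beta> l K y x = c"
    by (rule du_Bois_Reymond[OF assms(1) W_cont orth[folded K_def]], assumption, assumption, rule that)
  have D: "right_RL_derivative_exists a b \<alpha> (\<lambda>s. B1 s + B2 s) x"
    "right_RL_derivative a b \<alpha> (\<lambda>s. B1 s + B2 s) x = - q x" if "x \<in> {a..b}" for x
    using right_RL_derivative_eqI[OF assms(1,3) B q _ that, of c] c[unfolded W] by blast+
  \<comment> \<open>In contrast to the derivative, the integral of order \<beta> may always be
    separated, since both summands are continuous.\<close>
  have C_split: "right_RL_integral b \<beta> (\<lambda>s. C1 s + C2 s) x = right_RL_integral b \<beta> C1 x + right_RL_integral b \<beta> C2 x"
    if "x \<in> {a..b}" for x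
    by (rule right_RL_integral_add[OF assms(4)]; rule continuous_on_subset[OF cont(3)] continuous_on_subset[OF cont(6)])
      (use that in auto)
  have EL: "pd5_y K (Z x) + right_RL_derivative a b \<alpha> (\<lambda>s. B1 s + B2 s) x + right_RL_integral b \<beta> C1 x
      + M x * pd4_y l (Y x) + right_RL_integral b \<beta> C2 x = 0" if x: "x \<in> {a..b}" for x
    using D(2)[OF x] C_split[OF x] unfolding q_def by linarith
  have split: "right_RL_derivative_exists a b \<alpha> B1 x \<and> right_RL_derivative_exists a b \<alpha> B2 x \<and>
      right_RL_derivative a b \<alpha> (\<lambda>s. B1 s + B2 s) x = right_RL_derivative a b \<alpha> B1 x + right_RL_derivative a b \<alpha> B2 x"
    if x: "x \<in> {a..b}" and ex: "right_RL_derivative_exists a b \<alpha> B1 x \<or> right_RL_derivative_exists a b \<alpha> B2 x" for x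
    using ex
  proof
    assume 1: "right_RL_derivative_exists a b \<alpha> B1 x"
    from right_RL_derivative_split[OF assms(1,3) x cont(2,5) D(1)[OF x] 1] 1 show ?thesis by simp
  next
    assume 2: "right_RL_derivative_exists a b \<alpha> B2 x"
    from right_RL_derivative_split[OF assms(1,3) x cont(5,2) _ 2] D(1)[OF x] 2 show ?thesis
      by (simp add: add.commute)
  qed
  have "(\<forall>x\<in>{a..b}. right_RL_derivative_exists a b \<alpha> (\<lambda>s. B1 s + B2 s) x \<and>
        pd5_y K (Z x) + right_RL_derivative a b \<alpha> (\<lambda>s. B1 s + B2 s) x + right_RL_integral b \<beta> C1 x
          + M x * pd4_y l (Y x) + right_RL_integral b \<beta> C2 x = 0) \<and>
      (\<forall>x\<in>{a..b}. right_RL_derivative_exists a b \<alpha> B1 x \<or> right_RL_derivative_exists a b \<alpha> B2 x \<longrightarrow>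
        right_RL_derivative_exists a b \<alpha> B1 x \<and> right_RL_derivative_exists a b \<alpha> B2 x \<and>
        pd5_y K (Z x) + right_RL_derivative a b \<alpha> B1 x + right_RL_integral b \<beta> C1 x
          + M x * pd4_y l (Y x) + right_RL_derivative a b \<alpha> B2 x + right_RL_integral b \<beta> C2 x = 0)"
  proof (intro conjI ballI impI)
    fix x assume x: "x \<in> {a..b}"
    show "right_RL_derivative_exists a b \<alpha> (\<lambda>s. B1 s + B2 s) x" by (rule D(1)[OF x])
    show "pd5_y K (Z x) + right_RL_derivative a b \<alpha> (\<lambda>s. B1 s + B2 s) x + right_RL_integral b \<beta> C1 x
          + M x * pd4_y l (Y x) + right_RL_integral b \<beta> C2 x = 0" by (rule EL[OF x])
    assume ex: "right_RL_derivative_exists a b \<alpha> B1 x \<or> right_RL_derivative_exists a b \<alpha> B2 x"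
    show "right_RL_derivative_exists a b \<alpha> B1 x" "right_RL_derivative_exists a b \<alpha> B2 x"
      using split[OF x ex] by simp_all
    show "pd5_y K (Z x) + right_RL_derivative a b \<alpha> B1 x + right_RL_integral b \<beta> C1 x
          + M x * pd4_y l (Y x) + right_RL_derivative a b \<alpha> B2 x + right_RL_integral b \<beta> C2 x = 0"
      using split[OF x ex] EL[OF x] by linarith
  qed
  with nz show ?thesis
    unfolding Let_def B1_def B2_def C1_def C2_def M_def Y_def Z_def K_def by blast
qed

end
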